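(* Let $\ell>0$ be fixed. For $i=1,2$ let $\mathcal T_i$ be a finite equilateral compact metric tree with all edges of length $\ell$, having at most $9$ vertices (and at least two edges). Let real-valued potentials $q^{(i)}_{\mathsf e}\in L^2(0,\ell)$ be given on the edges $\mathsf e$ of $\mathcal T_i$, and let $\mathcal T_{i,\infty}$ be the metric tree obtained by attaching one lead $\mathsf e_0\cong[0,\infty)$, carrying the zero potential $q_0\equiv 0$, to some vertex $\mathsf v_i^*$ of $\mathcal T_i$. Consider on $\mathcal T_{i,\infty}$ the Schrödinger equation $-y''+qy=\lambda y$ with standard conditions at all vertices. Then the $S$-function together with the eigenvalues (both normal and embedded into the continuous spectrum) uniquely determines the shape of the compact tree: if the $S$-functions of the problems on $\mathcal T_{1,\infty}$ and $\mathcal T_{2,\infty}$ coincide, and if the eigenvalues (both normal and embedded, counted with multiplicity) of the two problems coincide, then the combinatorial trees underlying $\mathcal T_1$ and $\mathcal T_2$ are isomorphic.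
   Context: Metric tree: a compact metric graph has finite vertex set $\mathsf V$ and finite edge set $\mathsf E$; it is equilateral if every edge is identified with $[0,\ell]$ for one common $\ell$. It is a tree if the underlying combinatorial graph is a tree. Standard conditions at a vertex: the function is continuous there, and the sum of the derivatives along all incident edges, taken in the direction pointing away from the vertex, is zero (Kirchhoff condition; at a vertex of degree one this is the Neumann condition). The lead $\mathsf e_0$ counts as an edge incident to $\mathsf v^*$ in $\mathcal T_\infty$, directed away from $\mathsf v^*$. Problem I on $\mathcal T$: $-y_{\mathsf e}''+q_{\mathsf e}y_{\mathsf e}=\lambda y_{\mathsf e}$ on every edge of $\mathcal T$, with standard conditions at all vertices of $\mathcal T$. Problem II: the same, but with the Kirchhoff condition at $\mathsf v^*$ replaced by $y(\mathsf v^* )=0$. Characteristic functions: $\phi_N,\phi_D$ denote the characteristic functions of Problems I and II, i.e. (the determinants of the linear systems obtained by inserting the general solution on the edges into the vertex conditions) entire functions of $\lambda$ of order at most $1/2$ whose zeros, counted with multiplicity, are the eigenvalues of Problem I, resp. Problem II. They are normalised jointly (this fixes them up to a common nonzero constant) as follows: for $\phi_D(\lambda)\ne 0$, the unique solution $y$ on $\mathcal T$ of the equations which is continuous, satisfies standard conditions at all vertices other than $\mathsf v^*$, and has $y(\mathsf v^* )=\phi_D(\lambda)$, is such that minus the sum of the derivatives of $y$ at $\mathsf v^*$ along the edges of $\mathcal T$ in the directions away from $\mathsf v^*$ equals $\phi_N(\lambda)$. Thus the solution on $\mathcal T_\infty$ restricted to the lead is $y_0(x)=\phi_N(\lambda)\frac{\sin\sqrt\lambda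 x}{\sqrt\lambda}+\phi_D(\lambda)\cos\sqrt\lambda x$. Jost function and $S$-function: $E(k):=\phi_N(k^2)+ik\,\phi_D(k^2)$ and $S(k):=E(k)/E(-k)$, a meromorphic function of $k=\sqrt\lambda\in\mathbb C$. Eigenvalues: those of the self-adjoint operator $y\mapsto -y''+qy$ on $L^2(\mathcal T_\infty)$ with standard conditions at all vertices; normal eigenvalues are isolated eigenvalues of finite multiplicity (they lie on the negative half-axis), embedded eigenvalues are those lying in the essential spectrum $[0,\infty)$. *)

theory Defs
  imports "HOL-Complex_Analysis.Complex_Analysis" "HOL-Library.Function_Algebras"
begin

section \<open>Combinatorial trees\<close>

text \<open>
  An undirected graph is given by a vertex set \<open>V\<close> and a set \<open>E\<close> of ordered pairs, every
  undirected edge being listed exactly once, in an arbitrarily chosen orientation. On the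
  metric graph the edge \<open>(u, v)\<close> is \<open>[0, l]\<close> with \<open>0\<close> at \<open>u\<close> and \<open>l\<close> at \<open>v\<close>.
\<close>

definition adjacency :: "('v \<times> 'v) set \<Rightarrow> ('v \<times> 'v) set" where
  "adjacency E = E \<union> E\<inverse>"

definition is_cycle :: "('v \<times> 'v) set \<Rightarrow> 'v list \<Rightarrow> bool" where
  "is_cycle E p \<longleftrightarrow> length p \<ge> 3 \<and> distinct p \<and>
     (\<forall>i<length p. (p ! i, p ! (Suc i mod length p)) \<in> adjacency E)"

text \<open>
  \<^term>\<open>asym E\<close> excludes loops and the listing of one edge in both orientations, which
  would be a pair of parallel edges.
\<close>

definition finite_tree :: "'v set \<Rightarrow> ('v \<times> 'v) set \<Rightarrow> bool" where
  "finite_tree V E \<longleftrightarrow> finite V \<and> V \<noteq> {} \<and> E \<subseteq> V \<times> V \<and> asym E \<and>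
     (\<forall>u\<in>V. \<forall>v\<in>V. (u, v) \<in> (adjacency E)\<^sup>*) \<and> (\<nexists>p. is_cycle E p)"

definition graph_isomorphic ::
    "'v set \<Rightarrow> ('v \<times> 'v) set \<Rightarrow> 'w set \<Rightarrow> ('w \<times> 'w) set \<Rightarrow> bool" where
  "graph_isomorphic V E V' E' \<longleftrightarrow>
     (\<exists>f. bij_betw f V V' \<and>
       (\<forall>u\<in>V. \<forall>v\<in>V. (u, v) \<in> adjacency E \<longleftrightarrow> (f u, f v) \<in> adjacency E'))"

definition incident :: "('v \<times> 'v) set \<Rightarrow> 'v \<Rightarrow> ('v \<times> 'v) set" where
  "incident E v = {e \<in> E. fst e = v \<or> snd e = v}"


section \<open>The differential equation on an interval\<close>

definition L2_on :: "real set \<Rightarrow> (real \<Rightarrow> 'a::euclidean_space) \<Rightarrow> bool" where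
  "L2_on I f \<longleftrightarrow> set_borel_measurable lebesgue I f \<and>
     set_integrable lebesgue I (\<lambda>x. (norm (f x))\<^sup>2)"

text \<open>
  On an interval \<open>I\<close>: \<open>f\<close> is the continuous representative of an element of the Sobolev
  space \<open>H\<^sup>1(I)\<close> and \<open>g\<close> represents its weak derivative.
\<close>

definition H1_deriv :: "real set \<Rightarrow> (real \<Rightarrow> complex) \<Rightarrow> (real \<Rightarrow> complex) \<Rightarrow> bool" where
  "H1_deriv I f g \<longleftrightarrow> L2_on I f \<and> L2_on I g \<and>
     (\<forall>a\<in>I. \<forall>b\<in>I. a \<le> b \<longrightarrow> f b - f a = (LINT t:{a..b}|lebesgue. g t))"

text \<open>
  \<open>\<mu>\<close> is the spectral parameter. Solutions are sought in \<open>H\<^sup>2(I)\<close>, with \<open>g\<close> and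
  \<open>h\<close> the first and second derivative. In particular \<open>y\<close> is continuously differentiable
  on \<open>I\<close>, so that its one-sided derivatives at the end points exist.
\<close>

definition schroedinger ::
    "real set \<Rightarrow> (real \<Rightarrow> real) \<Rightarrow> complex \<Rightarrow> (real \<Rightarrow> complex) \<Rightarrow> bool" where
  "schroedinger I q \<mu> y \<longleftrightarrow>
     (\<exists>g h. H1_deriv I y g \<and> H1_deriv I g h \<and>
        (AE x in lebesgue. x \<in> I \<longrightarrow> - h x + of_real (q x) * y x = \<mu> * y x))"


section \<open>Trees with a lead and vertex conditions\<close>

record 'v lead_tree =
  vertices :: "'v set"
  edges :: "('v \<times> 'v) set"
  potential :: "'v \<times> 'v \<Rightarrow> real \<Rightarrow> real"
  lead_vertex :: 'v

definition equilateral_lead_tree :: "real \<Rightarrow> 'v lead_tree \<Rightarrow> bool" where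
  "equilateral_lead_tree l T \<longleftrightarrow> finite_tree (vertices T) (edges T) \<and>
     lead_vertex T \<in> vertices T \<and> (\<forall>e\<in>edges T. L2_on {0<..<l} (potential T e))"

text \<open>Value at the end point \<open>v\<close> of the edge \<open>e\<close>, and derivative there pointing away from \<open>v\<close>.\<close>

definition end_value :: "real \<Rightarrow> (real \<Rightarrow> complex) \<Rightarrow> 'v \<times> 'v \<Rightarrow> 'v \<Rightarrow> complex" where
  "end_value l f e v = (if v = fst e then f 0 else f l)"

definition outward_deriv :: "real \<Rightarrow> (real \<Rightarrow> complex) \<Rightarrow> 'v \<times> 'v \<Rightarrow> 'v \<Rightarrow> complex" where
  "outward_deriv l f e v =
     (if v = fst e then vector_derivative f (at 0 within {0..l})
      else - vector_derivative f (at l within {0..l}))"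

definition has_vertex_value ::
    "real \<Rightarrow> 'v lead_tree \<Rightarrow> ('v \<times> 'v \<Rightarrow> real \<Rightarrow> complex) \<Rightarrow> 'v \<Rightarrow> complex \<Rightarrow> bool" where
  "has_vertex_value l T y v c \<longleftrightarrow> (\<forall>e\<in>incident (edges T) v. end_value l (y e) e v = c)"

definition deriv_sum ::
    "real \<Rightarrow> 'v lead_tree \<Rightarrow> ('v \<times> 'v \<Rightarrow> real \<Rightarrow> complex) \<Rightarrow> 'v \<Rightarrow> complex" where
  "deriv_sum l T y v = (\<Sum>e\<in>incident (edges T) v. outward_deriv l (y e) e v)"

definition standard_at ::
    "real \<Rightarrow> 'v lead_tree \<Rightarrow> ('v \<times> 'v \<Rightarrow> real \<Rightarrow> complex) \<Rightarrow> 'v \<Rightarrow> bool" where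
  "standard_at l T y v \<longleftrightarrow> (\<exists>c. has_vertex_value l T y v c) \<and> deriv_sum l T y v = 0"

definition solves_inside ::
    "real \<Rightarrow> 'v lead_tree \<Rightarrow> complex \<Rightarrow> ('v \<times> 'v \<Rightarrow> real \<Rightarrow> complex) \<Rightarrow> bool" where
  "solves_inside l T \<mu> y \<longleftrightarrow>
     (\<forall>e\<in>edges T. schroedinger {0..l} (potential T e) \<mu> (y e)) \<and>
     (\<forall>v\<in>vertices T - {lead_vertex T}. standard_at l T y v)"


section \<open>Eigenspaces and multiplicities\<close>

text \<open>
  Functions on a metric graph are families of functions of a real variable, indexed by the
  edges; members of the eigenspaces vanish at all indices and arguments outside the graph, so
  that they are determined by their values on it. Dimensions are taken over the complex numbers.
\<close>

definition cscale :: "complex \<Rightarrow> ('e \<Rightarrow> real \<Rightarrow> complex) \<Rightarrow> 'e \<Rightarrow> real \<Rightarrow> complex" where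
  "cscale c y = (\<lambda>e x. c * y e x)"

interpretation graph_fun: vector_space cscale
  by unfold_locales (auto simp: cscale_def fun_eq_iff algebra_simps)

definition supported :: "('e \<Rightarrow> real set) \<Rightarrow> ('e \<Rightarrow> real \<Rightarrow> complex) \<Rightarrow> bool" where
  "supported D y \<longleftrightarrow> (\<forall>e x. x \<notin> D e \<longrightarrow> y e x = 0)"

definition compact_domain :: "real \<Rightarrow> 'v lead_tree \<Rightarrow> 'v \<times> 'v \<Rightarrow> real set" where
  "compact_domain l T e = (if e \<in> edges T then {0..l} else {})"

definition eigenspace_I ::
    "real \<Rightarrow> 'v lead_tree \<Rightarrow> complex \<Rightarrow> ('v \<times> 'v \<Rightarrow> real \<Rightarrow> complex) set" where
  "eigenspace_I l T \<mu> = {y. supported (compact_domain l T) y \<and> solves_inside l T \<mu> y \<and>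
     standard_at l T y (lead_vertex T)}"

definition eigenspace_II ::
    "real \<Rightarrow> 'v lead_tree \<Rightarrow> complex \<Rightarrow> ('v \<times> 'v \<Rightarrow> real \<Rightarrow> complex) set" where
  "eigenspace_II l T \<mu> = {y. supported (compact_domain l T) y \<and> solves_inside l T \<mu> y \<and>
     has_vertex_value l T y (lead_vertex T) 0}"

text \<open>
  On the tree with the lead, \<^const>\<open>None\<close> is the lead \<open>[0, \<infinity>)\<close> and \<open>Some e\<close> is the
  compact edge \<open>e\<close>. The equation on the lead, with \<open>I = [0, \<infinity>)\<close>, includes that the
  function lies in \<open>H\<^sup>2(0, \<infinity>)\<close>, hence in \<open>L\<^sup>2(0, \<infinity>)\<close>.
\<close>

definition lead_domain :: "real \<Rightarrow> 'v lead_tree \<Rightarrow> ('v \<times> 'v) option \<Rightarrow> real set" where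
  "lead_domain l T eo = (case eo of None \<Rightarrow> {0..} | Some e \<Rightarrow> compact_domain l T e)"

definition eigenspace_lead ::
    "real \<Rightarrow> 'v lead_tree \<Rightarrow> complex \<Rightarrow> (('v \<times> 'v) option \<Rightarrow> real \<Rightarrow> complex) set" where
  "eigenspace_lead l T \<mu> = {z. supported (lead_domain l T) z \<and>
     solves_inside l T \<mu> (\<lambda>e. z (Some e)) \<and>
     schroedinger {0..} (\<lambda>_. 0) \<mu> (z None) \<and>
     has_vertex_value l T (\<lambda>e. z (Some e)) (lead_vertex T) (z None 0) \<and>
     deriv_sum l T (\<lambda>e. z (Some e)) (lead_vertex T)
       + vector_derivative (z None) (at 0 within {0..}) = 0}"

definition multiplicity_I :: "real \<Rightarrow> 'v lead_tree \<Rightarrow> complex \<Rightarrow> nat" where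
  "multiplicity_I l T \<mu> = graph_fun.dim (eigenspace_I l T \<mu>)"

definition multiplicity_II :: "real \<Rightarrow> 'v lead_tree \<Rightarrow> complex \<Rightarrow> nat" where
  "multiplicity_II l T \<mu> = graph_fun.dim (eigenspace_II l T \<mu>)"

definition multiplicity_lead :: "real \<Rightarrow> 'v lead_tree \<Rightarrow> complex \<Rightarrow> nat" where
  "multiplicity_lead l T \<mu> = graph_fun.dim (eigenspace_lead l T \<mu>)"


section \<open>Characteristic functions and the S-function\<close>

definition entire_order_le :: "(complex \<Rightarrow> complex) \<Rightarrow> real \<Rightarrow> bool" where
  "entire_order_le f \<rho> \<longleftrightarrow> f holomorphic_on UNIV \<and>
     (\<forall>\<epsilon>>0. \<exists>C. \<forall>z. norm (f z) \<le> C * exp (norm z powr (\<rho> + \<epsilon>)))"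

text \<open>A number that is not an eigenvalue has multiplicity \<open>0\<close>, as has a point that is not a zero.\<close>

definition zeros_are_eigenvalues :: "(complex \<Rightarrow> complex) \<Rightarrow> (complex \<Rightarrow> nat) \<Rightarrow> bool" where
  "zeros_are_eigenvalues f m \<longleftrightarrow> (\<exists>z. f z \<noteq> 0) \<and> (\<forall>z. zorder f z = int (m z))"

text \<open>
  The pair \<open>(\<phi>\<^sub>N, \<phi>\<^sub>D)\<close> is determined by this up to a common nonzero constant factor, which
  cancels in the S-function below. The function \<open>y\<close> in the last clause is the unique
  solution on the compact tree with value \<open>\<phi>\<^sub>D(\<mu>)\<close> at the lead vertex.
\<close>

definition characteristic_functions ::
    "real \<Rightarrow> 'v lead_tree \<Rightarrow> (complex \<Rightarrow> complex) \<Rightarrow> (complex \<Rightarrow> complex) \<Rightarrow> bool" where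
  "characteristic_functions l T \<phi>\<^sub>N \<phi>\<^sub>D \<longleftrightarrow>
     entire_order_le \<phi>\<^sub>N (1/2) \<and> entire_order_le \<phi>\<^sub>D (1/2) \<and>
     zeros_are_eigenvalues \<phi>\<^sub>N (multiplicity_I l T) \<and>
     zeros_are_eigenvalues \<phi>\<^sub>D (multiplicity_II l T) \<and>
     (\<forall>\<mu> y. \<phi>\<^sub>D \<mu> \<noteq> 0 \<longrightarrow> solves_inside l T \<mu> y \<longrightarrow>
        has_vertex_value l T y (lead_vertex T) (\<phi>\<^sub>D \<mu>) \<longrightarrow>
        - deriv_sum l T y (lead_vertex T) = \<phi>\<^sub>N \<mu>)"

definition jost_function ::
    "(complex \<Rightarrow> complex) \<Rightarrow> (complex \<Rightarrow> complex) \<Rightarrow> complex \<Rightarrow> complex" where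
  "jost_function \<phi>\<^sub>N \<phi>\<^sub>D k = \<phi>\<^sub>N (k\<^sup>2) + \<i> * k * \<phi>\<^sub>D (k\<^sup>2)"

text \<open>
  As \<^term>\<open>a / 0 = (0::complex)\<close>, the values at the zeros of the denominator are
  meaningless; coincidence of two S-functions is equality of meromorphic functions, that is,
  equality outside a set without limit points.
\<close>

definition S_function ::
    "(complex \<Rightarrow> complex) \<Rightarrow> (complex \<Rightarrow> complex) \<Rightarrow> complex \<Rightarrow> complex" where
  "S_function \<phi>\<^sub>N \<phi>\<^sub>D k = jost_function \<phi>\<^sub>N \<phi>\<^sub>D k / jost_function \<phi>\<^sub>N \<phi>\<^sub>D (- k)"

end

theory Submission
  imports Defs
begin

text \<open>
  Since \<open>S(k) = (M + ik) / (M - ik)\<close> with \<open>M = \<phi>\<^sub>N(k\<^sup>2) / \<phi>\<^sub>D(k\<^sup>2)\<close>, the S-function determines \<open>M\<close>. Let \<open>k\<close> tend to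
  infinity near the points \<open>2 \<pi> n / l + i \<kappa>\<close>. The potentials become negligible while \<open>cos (k l)\<close> and
  \<open>sin (k l)\<close> stay put, so \<open>M / k\<close> tends to the value \<open>- i m\<close> of the problem with zero potential at \<open>i \<kappa>\<close>.
  With \<open>\<tau> = tanh (\<kappa> l)\<close> the number \<open>m\<close> is computed recursively from the tree rooted at the lead vertex: each
  branch at a vertex contributes \<open>(\<tau> + m') / (1 + \<tau> m')\<close>, where \<open>m'\<close> belongs to the root of the branch.
  For \<open>\<tau> = 2 / 3\<close> the numbers \<open>m\<close> of the rooted trees with at most nine vertices are pairwise distinct.
\<close>


section \<open>Weights of rooted trees\<close>

text \<open>Large \<open>k\<close> removes the unknown potentials; the shift by i kappa keeps the
  limit from degenerating. On the real axis the value at the root of the solution along a branch may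
  vanish, whereas for tau > 0 its limit is a positive multiple of 1 + tau m', because every m' is
  nonnegative. So the recursion never divides by zero and the limit always exists. The step 2 pi / l
  is a period of cos (k l) and sin (k l); this is where the common edge length enters. The
  S-functions agree only off a set without limit points, so the points are chosen near the
  translates of i kappa and need not hit them. Since w -> (w - 1) / (w + 1) is injective for w >= 0,
  the limit of S reveals the weight. A rational tau makes all weights rational, and their
  distinctness becomes a finite computation with integers. It runs over canonical representatives,
  in which the branches at each vertex are sorted by weight. The outcome is an isomorphism of trees
  rooted at the lead vertices.\<close>

text \<open>
  \<^term>\<open>Graft t s\<close> is the rooted tree obtained from \<open>s\<close> by joining its root to the root of \<open>t\<close>
  by a new edge, and \<^term>\<open>Leaf\<close> is a single vertex. The order in which branches are grafted is
  immaterial for the graph, so that a rooted tree has several such representations.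
\<close>

datatype btree = Leaf | Graft btree btree

text \<open>In \<open>Graft t1 (Graft t2 (... Leaf))\<close> the last \<open>Leaf\<close> is the
  root and the \<open>ti\<close> are its branches. Every vertex thus accounts for one
  \<open>Leaf\<close>, and this is the number of vertices.\<close>

primrec leaves :: "btree \<Rightarrow> nat" where
  "leaves Leaf = 1"
| "leaves (Graft t s) = leaves t + leaves s"

text \<open>
  Up to the factor \<open>- \<kappa>\<close>, the weight is the sum of the outward derivatives at the root of the
  solution with value \<open>1\<close> there, for the zero potential, \<open>\<lambda> = - \<kappa>\<^sup>2\<close> and \<open>tanh (\<kappa> l) = 2 / 3\<close>; the fraction
  is the addition theorem of the hyperbolic tangent. The value \<open>2 / 3\<close> is chosen because it separates
  all rooted trees with at most nine vertices, which \<open>1 / 2\<close> does not.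
\<close>

primrec weight :: "btree \<Rightarrow> real" where
  "weight Leaf = 0"
| "weight (Graft t s) = weight s + (2 + 3 * weight t) / (3 + 2 * weight t)"

text \<open>The value \<open>0\<close> for a vertex without branches acts as a least element,
  weights being nonnegative.\<close>

primrec head_weight :: "btree \<Rightarrow> real" where
  "head_weight Leaf = 0"
| "head_weight (Graft t s) = weight t"

text \<open>Canonical form of a rooted tree, sorted by weight at every vertex. If two different
  branches had the same weight, both orders would be \<open>descending\<close> and the distinctness
  check below would fail; its success settles the ties.\<close>

primrec descending :: "btree \<Rightarrow> bool" where
  "descending Leaf \<longleftrightarrow> True"
| "descending (Graft t s) \<longleftrightarrow> descending t \<and> descending s \<and> head_weight s \<le> weight t"

primrec sorted_graft :: "btree \<Rightarrow> btree \<Rightarrow> btree" where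
  "sorted_graft t Leaf = Graft t Leaf"
| "sorted_graft t (Graft t' s) =
     (if weight t' \<le> weight t then Graft t (Graft t' s) else Graft t' (sorted_graft t s))"

lemma weight_nonneg: "weight t \<ge> 0"
  by (induction t) auto

lemma leaves_pos: "leaves t > 0"
  by (induction t) auto

lemma head_weight_sorted_graft: "head_weight (sorted_graft t s) = max (weight t) (head_weight s)"
  by (cases s) (auto simp: weight_nonneg)

lemma descending_sorted_graft:
  "descending t \<Longrightarrow> descending s \<Longrightarrow> descending (sorted_graft t s)"
  by (induction s) (auto simp: weight_nonneg head_weight_sorted_graft)

section \<open>Enumeration of the canonical trees with exact weights\<close>

text \<open>
  An entry \<open>(t, n, d, h, k)\<close> records the tree \<open>t\<close>, its weight \<open>n / d\<close> and its head weight
  \<open>h / k\<close>.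
\<close>

type_synonym entry = "btree \<times> int \<times> int \<times> int \<times> int"

definition entry_valid :: "entry \<Rightarrow> bool" where
  "entry_valid = (\<lambda>(t, n, d, h, k). n \<ge> 0 \<and> d > 0 \<and> k > 0 \<and>
     weight t = of_int n / of_int d \<and> head_weight t = of_int h / of_int k)"

text \<open>The last condition in \<open>descending\<close>, cross-multiplied so that the evaluation
  stays within the integers.\<close>

fun graft_ok :: "entry \<Rightarrow> entry \<Rightarrow> bool" where
  "graft_ok (t, n, d, _) (s, _, _, h, k) \<longleftrightarrow> h * d \<le> n * k"

text \<open>Fractions are left unreduced: every comparison cross-multiplies, so common factors do no
  harm.\<close>

fun graft_entry :: "entry \<Rightarrow> entry \<Rightarrow> entry" where
  "graft_entry (t, n, d, _) (s, n', d', _) =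
     (Graft t s, n' * (3 * d + 2 * n) + (2 * d + 3 * n) * d', d' * (3 * d + 2 * n), n, d)"

definition combine :: "entry list \<Rightarrow> entry list \<Rightarrow> entry list" where
  "combine xs ys = concat (map (\<lambda>x. map (graft_entry x) (filter (graft_ok x) ys)) xs)"

text \<open>Index \<open>i\<close> holds trees with \<open>i + 1\<close> vertices. Zipping with the
  reversed list pairs index \<open>i\<close> with \<open>n - i\<close>; together these have
  \<open>n + 2\<close> vertices and belong at the new index \<open>n + 1\<close>.\<close>

primrec levels :: "nat \<Rightarrow> entry list list" where
  "levels 0 = [[(Leaf, 0, 1, 0, 1)]]"
| "levels (Suc n) = levels n @ [concat (map2 combine (levels n) (rev (levels n)))]"

lemma entry_valid_graft:
  assumes "entry_valid x" "entry_valid y" shows "entry_valid (graft_entry x y)"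
proof -
  obtain t n d h k where x: "x = (t, n, d, h, k)" by (metis surj_pair)
  obtain s n' d' h' k' where y: "y = (s, n', d', h', k')" by (metis surj_pair)
  have v: "n \<ge> 0" "d > 0" "n' \<ge> 0" "d' > 0" "weight t = of_int n / of_int d"
      "weight s = of_int n' / of_int d'"
    using assms unfolding x y entry_valid_def by auto
  have p: "3 * d + 2 * n > 0" using v by linarith
  have e: "(2 + 3 * weight t) / (3 + 2 * weight t) = of_int (2 * d + 3 * n) / of_int (3 * d + 2 * n)"
  proof -
    have "2 + 3 * weight t = of_int (2 * d + 3 * n) / of_int d"
        "3 + 2 * weight t = of_int (3 * d + 2 * n) / of_int d"
      using v by (simp_all add: field_simps)
    then show ?thesis using v by simp
  qed
  have "weight (Graft t s) =
      of_int (n' * (3 * d + 2 * n) + (2 * d + 3 * n) * d') / of_int (d' * (3 * d + 2 * n))"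
    unfolding weight.simps e unfolding v(6) using p v by (simp add: add_divide_distrib)
  then show ?thesis unfolding x y entry_valid_def using v p by simp
qed

lemma fst_graft_entry: "fst (graft_entry x y) = Graft (fst x) (fst y)"
  by (cases "(x, y)" rule: graft_entry.cases) simp

lemma graft_ok_iff:
  assumes "entry_valid x" "entry_valid y"
  shows "graft_ok x y \<longleftrightarrow> head_weight (fst y) \<le> weight (fst x)"
proof -
  obtain t n d h k where x: "x = (t, n, d, h, k)" by (metis surj_pair)
  obtain s n' d' h' k' where y: "y = (s, n', d', h', k')" by (metis surj_pair)
  have v: "d > 0" "k' > 0" "weight t = of_int n / of_int d" "head_weight s = of_int h' / of_int k'"
    using assms unfolding x y entry_valid_def by auto
  have "real_of_int h' / of_int k' \<le> of_int n / of_int d \<longleftrightarrow> real_of_int (h' * d) \<le> of_int (n * k')"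
    using v by (simp add: field_simps)
  then show ?thesis unfolding x y by (simp add: v del: of_int_mult)
qed

lemma length_levels: "length (levels m) = Suc m"
  by (induction m) auto

lemma set_map2: "set (map2 f xs ys) = {f (xs ! i) (ys ! i) | i. i < min (length xs) (length ys)}"
  by (auto simp: set_zip) 

lemma entry_valid_levels: "\<forall>xs\<in>set (levels m). \<forall>x\<in>set xs. entry_valid x"
proof (induction m)
  case 0
  then show ?case by (simp add: entry_valid_def)
next
  case (Suc m)
  have "entry_valid z" if "xs \<in> set (levels m)" "ys \<in> set (levels m)" "z \<in> set (combine xs ys)" for xs ys z
    using that Suc by (auto simp: combine_def intro!: entry_valid_graft)
  moreover have "\<exists>as\<in>set (levels m). \<exists>bs\<in>set (levels m). zs = combine as bs"
    if zs: "zs \<in> set (map2 combine (levels m) (rev (levels m)))" for zs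
  proof -
    obtain i where "zs = combine (levels m ! i) (rev (levels m) ! i)" "i < length (levels m)"
      using zs unfolding set_map2 by auto
    then show ?thesis by (metis nth_mem length_rev set_rev)
  qed
  ultimately have "entry_valid z" if "zs \<in> set (map2 combine (levels m) (rev (levels m)))" "z \<in> set zs" for zs z
    using that by blast
  then show ?case using Suc by (simp del: set_map)
qed

lemma levels_prefix: "i \<le> m \<Longrightarrow> levels m ! i = levels i ! i"
  by (induction m) (auto simp: nth_append length_levels le_Suc_eq)

text \<open>Both parts of a descending graft are descending and sit at smaller indices, and its head
  weight condition is exactly what \<open>graft_ok\<close> lets pass.\<close>

lemma levels_complete:
  "descending t \<Longrightarrow> leaves t = Suc m \<Longrightarrow> t \<in> fst ` set (levels m ! m)"
proof (induction t arbitrary: m)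
  case Leaf
  then show ?case by simp
next
  case (Graft t s)
  obtain i j where ij: "leaves t = Suc i" "leaves s = Suc j"
    using leaves_pos[of t] leaves_pos[of s] by (metis gr0_implies_Suc)
  obtain n where n: "m = Suc n" "n = i + j"
    using Graft.prems ij by simp
  obtain x y where x: "x \<in> set (levels n ! i)" "fst x = t" and y: "y \<in> set (levels n ! j)" "fst y = s"
    using Graft ij n levels_prefix[of i n] levels_prefix[of j n] by fastforce
  have v: "entry_valid x" "entry_valid y"
    using x y entry_valid_levels[of n] n by (auto simp: length_levels)
  have "graft_ok x y"
    unfolding graft_ok_iff[OF v] using x y Graft.prems by simp
  then have "graft_entry x y \<in> set (combine (levels n ! i) (levels n ! j))"
    using x y by (auto simp: combine_def)
  moreover have "combine (levels n ! i) (levels n ! j) \<in> set (map2 combine (levels n) (rev (levels n)))"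
    unfolding set_map2 using n by (auto simp: length_levels rev_nth intro!: exI[of _ i])
  ultimately have "graft_entry x y \<in> set (concat (map2 combine (levels n) (rev (levels n))))"
    unfolding set_concat by blast
  then have "graft_entry x y \<in> set (levels m ! m)"
    unfolding n(1) by (simp add: nth_append length_levels)
  moreover have "fst (graft_entry x y) = Graft t s"
    using x y by (simp add: fst_graft_entry)
  ultimately show ?case by force
qed

section \<open>Certifying that all weights differ\<close>

fun frac_merge :: "(int \<times> int) list \<Rightarrow> (int \<times> int) list \<Rightarrow> (int \<times> int) list" where
  "frac_merge [] ys = ys"
| "frac_merge xs [] = xs"
| "frac_merge ((a, b) # xs) ((c, d) # ys) =
     (if a * d < c * b then (a, b) # frac_merge xs ((c, d) # ys) else (c, d) # frac_merge ((a, b) # xs) ys)"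

fun merge_pairs :: "(int \<times> int) list list \<Rightarrow> (int \<times> int) list list" where
  "merge_pairs (xs # ys # zss) = frac_merge xs ys # merge_pairs zss"
| "merge_pairs xss = xss"

fun frac_ascending :: "(int \<times> int) list \<Rightarrow> bool" where
  "frac_ascending ((a, b) # (c, d) # xs) \<longleftrightarrow> a * d < c * b \<and> frac_ascending ((c, d) # xs)"
| "frac_ascending _ \<longleftrightarrow> True"

text \<open>The sorted list is tested for strict ascent afterwards, so all that the proof takes from
  merge sort is that the multiset is preserved. Sorting replaces the comparison of all pairs by a
  comparison of neighbours.\<close>

lemma mset_frac_merge: "mset (frac_merge xs ys) = mset xs + mset ys"
  by (induction xs ys rule: frac_merge.induct) auto

lemma mset_merge_pairs: "mset (concat (merge_pairs xss)) = mset (concat xss)"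
  by (induction xss rule: merge_pairs.induct) (auto simp: mset_frac_merge)

lemma mset_merge_pairs_funpow: "mset (concat ((merge_pairs ^^ k) xss)) = mset (concat xss)"
  by (induction k) (auto simp: mset_merge_pairs)

abbreviation frac_value :: "int \<times> int \<Rightarrow> real" where
  "frac_value p \<equiv> of_int (fst p) / of_int (snd p)"

text \<open>Positive denominators turn the cross-multiplied test into an inequality of values, and
  transitivity extends it from neighbours to all pairs.\<close>

lemma frac_ascending_sorted:
  assumes "frac_ascending xs" "\<forall>p\<in>set xs. snd p > 0"
  shows "sorted_wrt (<) (map frac_value xs)"
  using assms
proof (induction xs rule: frac_ascending.induct)
  case (1 a b c d xs)
  have "real_of_int (a * d) < of_int (c * b)" using 1 by (simp only: of_int_less_iff) simp
  then have "real_of_int a / b < real_of_int c / d" using 1 by (simp add: field_simps)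
  then show ?case using 1 by force
qed auto

definition level_fracs :: "nat \<Rightarrow> (int \<times> int) list" where
  "level_fracs m = map (\<lambda>(t, n, d, _). (n, d)) (concat (levels m))"

text \<open>There are \<open>486\<close> rooted trees with at most nine vertices, hence nine rounds of merging.\<close>

lemma level_fracs_ascending:
  "frac_ascending (concat ((merge_pairs ^^ 9) (map (\<lambda>p. [p]) (level_fracs 8))))"
proof -
  \<comment> \<open>\<open>levels\<close> recurses on \<open>Suc\<close>, so the numeral is written
    with successors before evaluation. Index \<open>8\<close> means up to nine vertices.\<close>
  have "(8 :: nat) = Suc (Suc (Suc (Suc (Suc (Suc (Suc (Suc 0)))))))" by simp
  then show ?thesis by (elim ssubst) code_simp
qed

text \<open>Every canonical tree of this size occurs in the enumeration, whose list of weights has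
  no repetition; equal weights therefore come from one and the same entry.\<close>

lemma weight_inj:
  assumes "descending s" "leaves s \<le> 9" "descending t" "leaves t \<le> 9" "weight s = weight t"
  shows "s = t"
proof -
  define ps where "ps = concat ((merge_pairs ^^ 9) (map (\<lambda>p. [p]) (level_fracs 8)))"
  let ?es = "concat (levels 8)"
  have m: "mset ps = mset (level_fracs 8)"
    by (simp add: ps_def mset_merge_pairs_funpow)
  have valid: "entry_valid x" if "x \<in> set ?es" for x
    using that entry_valid_levels[of 8] by auto
  have "snd p > 0" if "p \<in> set (level_fracs 8)" for p
    using that valid unfolding level_fracs_def by (fastforce simp: entry_valid_def simp del: set_concat)
  then have "\<forall>p\<in>set ps. snd p > 0"
    using mset_eq_setD[OF m] by blast
  from frac_ascending_sorted[OF _ this] level_fracs_ascending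
  have "distinct (map frac_value ps)"
    by (simp add: strict_sorted_iff ps_def)
  moreover have "mset (map frac_value ps) = mset (map frac_value (level_fracs 8))"
    by (simp only: mset_map m)
  ultimately have "distinct (map frac_value (level_fracs 8))"
    using mset_eq_imp_distinct_iff by blast
  moreover have "map frac_value (level_fracs 8) = map (\<lambda>x. weight (fst x)) ?es"
    unfolding level_fracs_def map_map
  proof (intro map_cong refl)
    fix x assume "x \<in> set ?es"
    from valid[OF this] show "(frac_value \<circ> (\<lambda>(t, n, d, _). (n, d))) x = weight (fst x)"
      by (cases x) (simp add: entry_valid_def)
  qed
  ultimately have inj: "inj_on (\<lambda>x. weight (fst x)) (set ?es)"
    by (simp add: distinct_map)
  have mem: "\<exists>x\<in>set ?es. fst x = u" if "descending u" "leaves u \<le> 9" for u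
  proof -
    obtain i where i: "leaves u = Suc i" using leaves_pos[of u] gr0_implies_Suc by blast
    then have "u \<in> fst ` set (levels 8 ! i)"
      using levels_complete[OF that(1) i] levels_prefix[of i 8] that(2) by simp
    moreover have "levels 8 ! i \<in> set (levels 8)"
      using i that(2) by (intro nth_mem) (simp add: length_levels)
    ultimately show ?thesis by auto
  qed
  obtain x where x: "x \<in> set ?es" "fst x = s" using mem[OF assms(1,2)] by (elim bexE) rule
  obtain y where y: "y \<in> set ?es" "fst y = t" using mem[OF assms(3,4)] by (elim bexE) rule
  have "weight (fst x) = weight (fst y)" by (simp only: x y assms(5))
  then have "x = y" using x(1) y(1) by (rule inj_onD[OF inj])
  then show "s = t" using x(2) y(2) by simp
qed


section \<open>Solutions on a single edge\<close>

lemma absolutely_integrable_on_mult_continuous: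
  fixes f \<phi> :: "real \<Rightarrow> complex"
  assumes "f absolutely_integrable_on {a..b}" "continuous_on {a..b} \<phi>"
  shows "(\<lambda>t. \<phi> t * f t) absolutely_integrable_on {a..b}"
proof -
  have "bilinear ((*) :: complex \<Rightarrow> complex \<Rightarrow> complex)"
    by (simp add: bilinear_conv_bounded_bilinear bounded_bilinear_mult)
  then show ?thesis
  proof (rule absolutely_integrable_bounded_measurable_product)
    show "\<phi> \<in> borel_measurable (lebesgue_on {a..b})"
      using assms(2) by (rule continuous_imp_measurable_on_sets_lebesgue) simp
    show "bounded (\<phi> ` {a..b})"
      using assms(2) by (intro compact_imp_bounded compact_continuous_image) auto
  qed (simp_all add: assms(1))
qed

lemma norm_integral_le:
  fixes f g :: "real \<Rightarrow> complex"
  assumes "f absolutely_integrable_on {a..b}" "g integrable_on {a..b}"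
    "\<And>t. t \<in> {a..b} \<Longrightarrow> norm (g t) \<le> C * norm (f t)"
  shows "norm (integral {a..b} g) \<le> C * integral {a..b} (\<lambda>t. norm (f t))"
proof -
  have "(\<lambda>t. norm (f t)) integrable_on {a..b}"
    using assms(1) by (simp add: absolutely_integrable_on_def)
  then have "norm (integral {a..b} g) \<le> integral {a..b} (\<lambda>t. C * norm (f t))"
    using assms by (intro integral_norm_bound_integral) (auto intro: integrable_on_mult_right)
  then show ?thesis by simp
qed

text \<open>Continuity of \<open>W\<close> makes the increments of \<open>H\<close> of smaller order
  than \<open>b - a\<close>, so \<open>H\<close> has derivative zero at every point. This avoids
  arguing with derivatives that exist only almost everywhere.\<close>

lemma zero_derivative_if_superlinear:
  fixes H :: "real \<Rightarrow> complex" and W :: "real \<Rightarrow> real"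
  assumes W: "continuous_on {0..l} W"
    and H: "\<And>a b. 0 \<le> a \<Longrightarrow> a \<le> b \<Longrightarrow> b \<le> l \<Longrightarrow> norm (H b - H a) \<le> C * (b - a) * (W b - W a)"
    and "C > 0" and x: "x \<in> {0..l}"
  shows "H x = H 0"
proof -
  have "\<exists>c. \<forall>x\<in>{0..l}. H x = c"
  proof (rule has_derivative_zero_constant)
    fix x assume x: "x \<in> {0..l}"
    show "(H has_derivative (\<lambda>h. 0)) (at x within {0..l})"
      unfolding has_derivative_within_alt
    proof (intro conjI allI impI)
      fix e :: real assume "e > 0"
      then have "e / C > 0" using \<open>C > 0\<close> by simp
      from W[unfolded continuous_on_iff, rule_format, OF x this]
      obtain d where d: "d > 0" "\<And>y. y \<in> {0..l} \<Longrightarrow> dist y x < d \<Longrightarrow> dist (W y) (W x) < e / C"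
        by blast
      have "norm (H y - H x) \<le> e * norm (y - x)" if y: "y \<in> {0..l}" "norm (y - x) < d" for y
      proof -
        have *: "norm (H y - H x) \<le> C * \<bar>y - x\<bar> * \<bar>W y - W x\<bar>"
        proof (cases "x \<le> y")
          case True
          then have "C * (y - x) * (W y - W x) \<le> C * \<bar>y - x\<bar> * \<bar>W y - W x\<bar>"
            using \<open>C > 0\<close> mult_left_mono[OF abs_ge_self, of "C * (y - x)" "W y - W x"] by simp
          then show ?thesis using H[of x y] True x y by auto
        next
          case False
          then have "C * (x - y) * (W x - W y) \<le> C * \<bar>y - x\<bar> * \<bar>W y - W x\<bar>"
            using \<open>C > 0\<close> mult_left_mono[OF abs_ge_self, of "C * (x - y)" "W x - W y"]
            by (simp add: abs_minus_commute)
          then show ?thesis using H[of y x] False x y by (auto simp: norm_minus_commute)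
        qed
        have "\<bar>W y - W x\<bar> \<le> e / C"
          using d(2)[OF y(1)] y(2) by (simp add: dist_real_def)
        then have "C * \<bar>y - x\<bar> * \<bar>W y - W x\<bar> \<le> C * \<bar>y - x\<bar> * (e / C)"
          using \<open>C > 0\<close> by (intro mult_left_mono) auto
        then show ?thesis using * \<open>C > 0\<close> by (simp add: mult.commute)
      qed
      then show "\<exists>d>0. \<forall>y\<in>{0..l}. norm (y - x) < d \<longrightarrow> norm (H y - H x - 0) \<le> e * norm (y - x)"
        using d(1) by auto
    qed simp
  qed simp
  then show ?thesis using x by force
qed

text \<open>
  The difference of both sides has increments of order \<open>(b - a)\<close> times the increment of the
  continuous function \<open>\<integral>\<bar>f\<bar>\<close>, hence derivative zero.
\<close>

lemma indefinite_integral_mult: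
  fixes f \<phi> \<phi>' G :: "real \<Rightarrow> complex"
  assumes f: "f absolutely_integrable_on {0..l}"
    and \<phi>: "\<And>x. x \<in> {0..l} \<Longrightarrow> (\<phi> has_vector_derivative \<phi>' x) (at x within {0..l})"
    and \<phi>': "continuous_on {0..l} \<phi>'"
    and G: "\<And>x. x \<in> {0..l} \<Longrightarrow> G x = G 0 + integral {0..x} f"
    and x: "x \<in> {0..l}"
  shows "((\<lambda>t. f t * \<phi> t + G t * \<phi>' t) has_integral G x * \<phi> x - G 0 * \<phi> 0) {0..x}"
proof -
  have sub: "f absolutely_integrable_on {a..b}" if "0 \<le> a" "b \<le> l" for a b
    by (rule absolutely_integrable_on_subinterval[OF f]) (use that in auto)
  have fi: "f integrable_on {a..b}" if "0 \<le> a" "b \<le> l" for a b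
    using sub[OF that] by (simp add: absolutely_integrable_on_def)
  have cont\<phi>: "continuous_on {0..l} \<phi>"
    using \<phi> by (meson continuous_on_eq_continuous_within has_vector_derivative_continuous)
  have contG: "continuous_on {0..l} G"
  proof -
    have "continuous_on {0..l} (\<lambda>x. G 0 + integral {0..x} f)"
      using fi by (intro continuous_intros indefinite_integral_continuous_1) auto
    then show ?thesis by (rule continuous_on_eq) (rule G[symmetric])
  qed
  obtain B where B: "B > 0" "\<And>t. t \<in> {0..l} \<Longrightarrow> norm (\<phi>' t) \<le> B"
    using compact_imp_bounded[OF compact_continuous_image[OF \<phi>' compact_Icc]]
    unfolding bounded_pos by blast
  define W where "W x = integral {0..x} (\<lambda>t. norm (f t))" for x
  have nfi: "(\<lambda>t. norm (f t)) integrable_on {a..b}" if "0 \<le> a" "b \<le> l" for a b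
    using sub[OF that] by (simp add: absolutely_integrable_on_def)
  have W: "W b - W a = integral {a..b} (\<lambda>t. norm (f t))" if "0 \<le> a" "a \<le> b" "b \<le> l" for a b
    using Henstock_Kurzweil_Integration.integral_combine[of 0 a b "\<lambda>t. norm (f t)"] nfi that by (simp add: W_def)
  have contW: "continuous_on {0..l} W"
    unfolding W_def using nfi by (intro indefinite_integral_continuous_1) auto
  have Gd: "G b - G a = integral {a..b} f" if "0 \<le> a" "a \<le> b" "b \<le> l" for a b
    using Henstock_Kurzweil_Integration.integral_combine[of 0 a b f] fi that G[of a] G[of b]
    by (simp add: algebra_simps)
  have \<phi>d: "(\<phi>' has_integral (\<phi> b - \<phi> a)) {a..b}" if "0 \<le> a" "a \<le> b" "b \<le> l" for a b
    using that by (intro fundamental_theorem_of_calculus has_vector_derivative_within_subset[OF \<phi>]) auto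
  let ?h = "\<lambda>t. f t * \<phi> t + G t * \<phi>' t"
  have hi: "?h integrable_on {a..b}" if "0 \<le> a" "b \<le> l" for a b
  proof (intro integrable_add)
    have "(\<lambda>t. \<phi> t * f t) absolutely_integrable_on {a..b}"
      using sub[OF that] that
      by (intro absolutely_integrable_on_mult_continuous continuous_on_subset[OF cont\<phi>]) auto
    then show "(\<lambda>t. f t * \<phi> t) integrable_on {a..b}"
      by (simp add: absolutely_integrable_on_def mult.commute)
    show "(\<lambda>t. G t * \<phi>' t) integrable_on {a..b}"
      using that by (intro integrable_continuous_real continuous_intros
          continuous_on_subset[OF contG] continuous_on_subset[OF \<phi>']) auto
  qed
  define H where "H x = G x * \<phi> x - integral {0..x} ?h" for x
  have "H x = H 0"
  proof (rule zero_derivative_if_superlinear[OF contW _ _ x])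
    show "2 * B > 0" using B by simp
    fix a b assume ab: "0 \<le> a" "a \<le> b" "b \<le> l"
    have le: "0 \<le> b" "a \<le> l" using ab by auto
    have \<phi>l: "norm (\<phi> b - \<phi> t) \<le> B * (b - a)" if "t \<in> {a..b}" for t
    proof -
      have "norm (integral {t..b} \<phi>') \<le> B * (b - t)"
        using that ab B \<phi>d[of t b] by (intro integral_bound continuous_on_subset[OF \<phi>']) auto
      also have "\<dots> \<le> B * (b - a)" using that B by auto
      finally show ?thesis using \<phi>d[of t b] that ab by (simp add: has_integral_iff)
    qed
    have Gl: "norm (G a - G t) \<le> W b - W a" if "t \<in> {a..b}" for t
    proof -
      have "norm (integral {a..t} f) \<le> 1 * integral {a..t} (\<lambda>t. norm (f t))"
        using that ab sub[of a t] fi[of a t] by (intro norm_integral_le) auto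
      also have "\<dots> \<le> W b - W a"
        using that ab W[of a b] nfi[of a b] nfi[of a t] by (auto intro!: integral_subset_le)
      finally show ?thesis using Gd[of a t] that ab by (simp add: norm_minus_commute[of "G a"])
    qed
    \<comment> \<open>Freezing \<open>\<phi>\<close> at \<open>b\<close> and \<open>G\<close> at
      \<open>a\<close> makes the integral telescope exactly to the increment of the product. The
      error against \<open>?h\<close> is a product of two small quantities, one Lipschitz and one
      controlled by \<open>W\<close>.\<close>
    have i1: "((\<lambda>t. f t * \<phi> b) has_integral (G b - G a) * \<phi> b) {a..b}"
      using fi[of a b] ab Gd[of a b] by (intro has_integral_mult_left) (simp add: has_integral_integral)
    have i2: "((\<lambda>t. G a * \<phi>' t) has_integral G a * (\<phi> b - \<phi> a)) {a..b}"
      using \<phi>d[of a b] ab by (intro has_integral_mult_right) auto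
    have i3: "(?h has_integral integral {a..b} ?h) {a..b}"
      using hi[of a b] ab by (simp add: has_integral_integral)
    have i4: "((\<lambda>t. (f t * \<phi> b + G a * \<phi>' t) - ?h t) has_integral
        ((G b - G a) * \<phi> b + G a * (\<phi> b - \<phi> a)) - integral {a..b} ?h) {a..b}"
      by (intro has_integral_diff has_integral_add i1 i2 i3)
    have "H b - H a = ((G b - G a) * \<phi> b + G a * (\<phi> b - \<phi> a)) - integral {a..b} ?h"
      using Henstock_Kurzweil_Integration.integral_combine[of 0 a b ?h] hi[of 0 b] ab
      by (simp add: H_def algebra_simps)
    then have i5: "((\<lambda>t. (f t * \<phi> b + G a * \<phi>' t) - ?h t) has_integral H b - H a) {a..b}"
      using i4 by simp
    have r: "((\<lambda>t. (B * (b - a)) * norm (f t) + (W b - W a) * B) has_integral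
        (B * (b - a)) * (W b - W a) + (b - a) *\<^sub>R ((W b - W a) * B)) {a..b}"
      using nfi[of a b] W[OF ab] ab
        has_integral_const_real[of "(W b - W a) * B" a b]
      by (intro has_integral_add has_integral_mult_right) (simp_all add: has_integral_integral)
    have "norm (integral {a..b} (\<lambda>t. (f t * \<phi> b + G a * \<phi>' t) - ?h t)) \<le>
        integral {a..b} (\<lambda>t. (B * (b - a)) * norm (f t) + (W b - W a) * B)"
    proof (rule integral_norm_bound_integral)
      fix t assume t: "t \<in> {a..b}"
      have "(f t * \<phi> b + G a * \<phi>' t) - ?h t = f t * (\<phi> b - \<phi> t) + (G a - G t) * \<phi>' t"
        by (simp add: algebra_simps)
      also have "norm \<dots> \<le> norm (f t) * (B * (b - a)) + (W b - W a) * B"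
        unfolding norm_mult using t ab \<phi>l[OF t] Gl[OF t] B
        by (intro norm_triangle_mono) (auto simp: norm_mult intro!: mult_mono order_trans[OF norm_ge_zero Gl[OF t]])
      finally show "norm ((f t * \<phi> b + G a * \<phi>' t) - ?h t) \<le> (B * (b - a)) * norm (f t) + (W b - W a) * B"
        by (simp add: mult.commute)
    qed (use i5 r in \<open>auto simp: has_integral_iff\<close>)
    also have "integral {a..b} (\<lambda>t. (f t * \<phi> b + G a * \<phi>' t) - ?h t) = H b - H a"
      using i5 by (rule integral_unique)
    also have "integral {a..b} (\<lambda>t. (B * (b - a)) * norm (f t) + (W b - W a) * B)
        = 2 * B * (b - a) * (W b - W a)"
      using integral_unique[OF r] by (simp add: algebra_simps)
    finally show "norm (H b - H a) \<le> 2 * B * (b - a) * (W b - W a)" .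
  qed
  then have "integral {0..x} ?h = G x * \<phi> x - G 0 * \<phi> 0" by (simp add: H_def algebra_simps)
  moreover have "?h integrable_on {0..x}" using hi[of 0 x] x by simp
  ultimately show ?thesis by (simp add: has_integral_iff)
qed

section \<open>Solving the equation on an edge for large k\<close>

lemma continuous_contraction_fixpoint:
  fixes T :: "(real \<Rightarrow> complex) \<Rightarrow> real \<Rightarrow> complex"
  assumes "l \<ge> 0"
    and cont: "\<And>y. continuous_on {0..l} y \<Longrightarrow> continuous_on {0..l} (T y)"
    and contr: "\<And>y z M x. continuous_on {0..l} y \<Longrightarrow> continuous_on {0..l} z \<Longrightarrow>
      (\<And>t. t \<in> {0..l} \<Longrightarrow> norm (y t - z t) \<le> M) \<Longrightarrow> x \<in> {0..l} \<Longrightarrow> norm (T y x - T z x) \<le> M / 2"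
  shows "\<exists>y. continuous_on {0..l} y \<and> (\<forall>x\<in>{0..l}. y x = T y x)"
proof -
  \<comment> \<open>Clamping the argument to \<open>{0..l}\<close> extends functions continuously
    and boundedly to the line, so Banach's theorem applies in the complete space of bounded
    continuous functions.\<close>
  define c where "c x = max 0 (min l x)" for x
  have c: "c x \<in> {0..l}" for x using \<open>l \<ge> 0\<close> by (auto simp: c_def)
  have contc: "continuous_on UNIV c" unfolding c_def by (intro continuous_intros)
  define F where "F u = Bcontfun (\<lambda>x. T (apply_bcontfun u) (c x))" for u :: "real \<Rightarrow>\<^sub>C complex"
  have F: "apply_bcontfun (F u) x = T (apply_bcontfun u) (c x)" for u x
  proof -
    have k: "continuous_on {0..l} (T (apply_bcontfun u))" by (intro cont) simp
    obtain B where "\<forall>x\<in>T (apply_bcontfun u) ` {0..l}. norm x \<le> B"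
      using compact_imp_bounded[OF compact_continuous_image[OF k compact_Icc]]
      unfolding bounded_iff by blast
    then have "(\<lambda>x. T (apply_bcontfun u) (c x)) \<in> bcontfun"
      using c by (intro bcontfun_normI[where b = B] continuous_on_compose2[OF k contc]) auto
    then show ?thesis unfolding F_def by (simp add: Bcontfun_inverse)
  qed
  have "dist (F u) (F v) \<le> 1/2 * dist u v" for u v
  proof (rule dist_bound)
    fix x
    have "norm (T (apply_bcontfun u) (c x) - T (apply_bcontfun v) (c x)) \<le> dist u v / 2"
      using c dist_bounded[of u _ v] by (intro contr) (auto simp: dist_norm)
    then show "dist (apply_bcontfun (F u) x) (apply_bcontfun (F v) x) \<le> 1/2 * dist u v"
      by (simp add: F dist_norm)
  qed
  then obtain u where u: "F u = u"
    using banach_fix_type[of "1/2" F] by auto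
  have "apply_bcontfun u x = T (apply_bcontfun u) x" if "x \<in> {0..l}" for x
    using F[of u x] that unfolding u by (simp add: c_def)
  then show ?thesis by (intro exI[of _ "apply_bcontfun u"]) auto
qed


lemma L2_on_iff_measurable:
  "S \<in> sets lebesgue \<Longrightarrow> L2_on S f \<longleftrightarrow>
     f \<in> borel_measurable (lebesgue_on S) \<and> (\<lambda>x. (norm (f x))\<^sup>2) absolutely_integrable_on S"
  unfolding L2_on_def set_borel_measurable_def
  by (subst borel_measurable_restrict_space_iff) auto

lemma L2_on_bounded:
  fixes f :: "real \<Rightarrow> 'a::euclidean_space"
  assumes "f \<in> borel_measurable (lebesgue_on {a..b})"
    and "(\<lambda>x. g x) integrable_on {a..b}" "\<And>x. x \<in> {a..b} \<Longrightarrow> (norm (f x))\<^sup>2 \<le> g x"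
  shows "L2_on {a..b} f"
proof -
  have "(\<lambda>x. (norm (f x))\<^sup>2) absolutely_integrable_on {a..b}"
    using assms by (intro measurable_bounded_by_integrable_imp_absolutely_integrable[where g = g]) auto
  then show ?thesis using assms(1) by (simp add: L2_on_iff_measurable)
qed

lemma L2_on_continuous:
  fixes f :: "real \<Rightarrow> 'a::euclidean_space"
  assumes "continuous_on {a..b} f"
  shows "L2_on {a..b} f"
  using assms
  by (intro L2_on_bounded[where g = "\<lambda>x. (norm (f x))\<^sup>2"] integrable_continuous_real continuous_intros
      continuous_imp_measurable_on_sets_lebesgue) auto

text \<open>On a set of finite measure \<open>1 + t^2\<close> is an integrable majorant of
  \<open>t\<close>.\<close>

lemma L2_on_imp_absolutely_integrable:
  fixes f :: "real \<Rightarrow> 'a::euclidean_space"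
  assumes "L2_on S f" "S \<in> lmeasurable"
  shows "f absolutely_integrable_on S" "(\<lambda>x. (norm (f x))\<^sup>2) absolutely_integrable_on S"
proof -
  have f: "f \<in> borel_measurable (lebesgue_on S)" "(\<lambda>x. (norm (f x))\<^sup>2) absolutely_integrable_on S"
    using assms by (simp_all add: L2_on_iff_measurable fmeasurableD)
  then show "(\<lambda>x. (norm (f x))\<^sup>2) absolutely_integrable_on S" by simp
  show "f absolutely_integrable_on S"
  proof (rule measurable_bounded_by_integrable_imp_absolutely_integrable[OF f(1) fmeasurableD[OF assms(2)]])
    show "(\<lambda>x. 1 + (norm (f x))\<^sup>2) integrable_on S"
      using f(2) assms(2) by (intro integrable_add) (auto intro!: integrable_on_const simp: absolutely_integrable_on_def)
    show "norm (f x) \<le> 1 + (norm (f x))\<^sup>2" for x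
    proof -
      have "2 * norm (f x) \<le> 1 + (norm (f x))\<^sup>2" using sum_squares_bound[of 1 "norm (f x)"] by simp
      then show ?thesis using zero_le_power2[of "norm (f x)"] by linarith
    qed
  qed
qed

lemma L2_on_Ioo_absolutely_integrable:
  fixes q :: "real \<Rightarrow> real"
  assumes "L2_on {a<..<b} q"
  shows "q absolutely_integrable_on {a..b}" "(\<lambda>x. (q x)\<^sup>2) absolutely_integrable_on {a..b}"
  using L2_on_imp_absolutely_integrable[OF assms] by (simp_all add: absolutely_integrable_on_Icc_iff_Ioo)

lemma H1_derivI:
  assumes g: "g absolutely_integrable_on {0..l}" "L2_on {0..l} g"
    and y: "\<And>x. x \<in> {0..l} \<Longrightarrow> (g has_integral y x - y 0) {0..x}"
  shows "H1_deriv {0..l} y g"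
  unfolding H1_deriv_def
proof (intro conjI ballI impI g)
  have eq: "y x = y 0 + integral {0..x} g" if "x \<in> {0..l}" for x
    using y[OF that] by (simp add: has_integral_iff)
  have gi: "g integrable_on {0..l}" using g by (simp add: absolutely_integrable_on_def)
  have "continuous_on {0..l} (\<lambda>x. y 0 + integral {0..x} g)"
    by (intro continuous_intros indefinite_integral_continuous_1 gi)
  then have "continuous_on {0..l} y"
    by (rule continuous_on_eq) (rule eq[symmetric])
  then show "L2_on {0..l} y" by (rule L2_on_continuous)
  fix a b assume ab: "a \<in> {0..l}" "b \<in> {0..l}" "a \<le> b"
  have "y b - y a = integral {a..b} g"
    using Henstock_Kurzweil_Integration.integral_combine[of 0 a b g] y[of b] ab eq[of a] eq[of b]
    by (auto simp: has_integral_iff algebra_simps)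
  moreover have "g absolutely_integrable_on {a..b}"
    by (rule absolutely_integrable_on_subinterval[OF g(1)]) (use ab in auto)
  ultimately show "y b - y a = (LINT t:{a..b}|lebesgue. g t)"
    by (simp add: set_lebesgue_integral_eq_integral)
qed

text \<open>Variation of constants: \<open>y = cos (k x) p + sin (k x) r\<close>, with
  \<open>p\<close> and \<open>r\<close> constant up to an error of order \<open>1 / norm k\<close>.
  Slopes are measured in units of \<open>k\<close>, so that the free solution carries
  \<open>(a, b)\<close> to \<open>l\<close> by a rotation matrix whose entries depend on
  \<open>k\<close> only through \<open>cos (k l)\<close> and \<open>sin (k l)\<close>.\<close>

lemma schroedinger_solution_exists:
  fixes q :: "real \<Rightarrow> real" and k a b :: complex
  assumes l: "l > 0" and q: "L2_on {0<..<l} q"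
    and C: "\<And>x. x \<in> {0..l} \<Longrightarrow> norm (cos (k * of_real x)) \<le> C"
      "\<And>x. x \<in> {0..l} \<Longrightarrow> norm (sin (k * of_real x)) \<le> C"
    and k: "k \<noteq> 0" "4 * C\<^sup>2 * integral {0..l} (\<lambda>t. \<bar>q t\<bar>) \<le> norm k"
  defines "\<epsilon> \<equiv> 2 * C\<^sup>2 * integral {0..l} (\<lambda>t. \<bar>q t\<bar>) * (norm a + norm b) / norm k"
  shows "\<exists>y p r. schroedinger {0..l} q (k\<^sup>2) y \<and>
    y 0 = a \<and> (y has_vector_derivative k * b) (at 0 within {0..l}) \<and>
    y l = cos (k * of_real l) * p + sin (k * of_real l) * r \<and>
    (y has_vector_derivative k * (cos (k * of_real l) * r - sin (k * of_real l) * p)) (at l within {0..l}) \<and>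
    norm (p - a) \<le> \<epsilon> \<and> norm (r - b) \<le> \<epsilon>"
proof -
  define cs where "cs x = cos (k * of_real x)" for x :: real
  define sn where "sn x = sin (k * of_real x)" for x :: real
  define N where "N = integral {0..l} (\<lambda>t. \<bar>q t\<bar>)"
  have cs0: "cs 0 = 1" and sn0: "sn 0 = 0" by (simp_all add: cs_def sn_def)
  have cs': "(cs has_vector_derivative - k * sn x) (at x within S)" for x S
    unfolding cs_def sn_def
    by (rule has_vector_derivative_real_field[where f = "\<lambda>x. cos (k * x)"]) (auto intro!: derivative_eq_intros)
  have sn': "(sn has_vector_derivative k * cs x) (at x within S)" for x S
    unfolding cs_def sn_def
    by (rule has_vector_derivative_real_field[where f = "\<lambda>x. sin (k * x)"]) (auto intro!: derivative_eq_intros)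
  have contcs: "continuous_on S cs" and contsn: "continuous_on S sn" for S
    unfolding cs_def sn_def by (intro continuous_intros)+
  have C': "norm (cs x) \<le> C" "norm (sn x) \<le> C" if "x \<in> {0..l}" for x
    using C[OF that] by (simp_all add: cs_def sn_def)
  have C0: "C \<ge> 0" using C'(1)[of 0] l norm_ge_zero order_trans by (metis atLeastAtMost_iff less_eq_real_def)
  have qi: "(\<lambda>t. complex_of_real (q t)) absolutely_integrable_on {0..l}"
    using L2_on_Ioo_absolutely_integrable(1)[OF q] absolutely_integrable_linear[OF _ bounded_linear_of_real]
    by (simp add: o_def)
  have N0: "N \<ge> 0" unfolding N_def
    using L2_on_Ioo_absolutely_integrable(1)[OF q] by (intro integral_nonneg) (auto simp: absolutely_integrable_on_def)

  define I where "I \<phi> y x = integral {0..x} (\<lambda>t. \<phi> t / k * y t * of_real (q t))" for \<phi> y :: "real \<Rightarrow> complex" and x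
  have ai: "(\<lambda>t. \<phi> t / k * y t * of_real (q t)) absolutely_integrable_on {0..l}"
    if "continuous_on {0..l} \<phi>" "continuous_on {0..l} y" for \<phi> y :: "real \<Rightarrow> complex"
    using that k by (intro absolutely_integrable_on_mult_continuous[OF qi] continuous_intros) auto
  have aix: "(\<lambda>t. \<phi> t / k * y t * of_real (q t)) absolutely_integrable_on {0..x}"
    if "continuous_on {0..l} \<phi>" "continuous_on {0..l} y" "x \<in> {0..l}" for \<phi> y :: "real \<Rightarrow> complex" and x
    by (rule absolutely_integrable_on_subinterval[OF ai]) (use that in auto)
  have contI: "continuous_on {0..l} (I \<phi> y)"
    if "continuous_on {0..l} \<phi>" "continuous_on {0..l} y" for \<phi> y
    unfolding I_def using ai[OF that]
    by (intro indefinite_integral_continuous_1) (simp add: absolutely_integrable_on_def)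
  have Idiff: "I \<phi> y x - I \<phi> z x = I \<phi> (\<lambda>t. y t - z t) x"
    if "continuous_on {0..l} \<phi>" "continuous_on {0..l} y" "continuous_on {0..l} z" "x \<in> {0..l}" for \<phi> y z x
  proof -
    have "I \<phi> y x - I \<phi> z x =
        integral {0..x} (\<lambda>t. \<phi> t / k * y t * of_real (q t) - \<phi> t / k * z t * of_real (q t))"
      unfolding I_def using aix that by (subst Henstock_Kurzweil_Integration.integral_diff) (auto simp: absolutely_integrable_on_def)
    then show ?thesis unfolding I_def by (simp add: algebra_simps)
  qed
  have Ile: "norm (I \<phi> y x) \<le> C * M / norm k * N"
    if \<phi>: "continuous_on {0..l} \<phi>" "\<And>x. x \<in> {0..l} \<Longrightarrow> norm (\<phi> x) \<le> C" and y: "continuous_on {0..l} y"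
      "\<And>t. t \<in> {0..l} \<Longrightarrow> norm (y t) \<le> M" and x: "x \<in> {0..l}" for \<phi> y x M
  proof -
    have M0: "M \<ge> 0" using y(2)[OF x] norm_ge_zero order_trans by blast
    have "norm (I \<phi> y x) \<le> C * M / norm k * integral {0..x} (\<lambda>t. norm (complex_of_real (q t)))"
      unfolding I_def
    proof (rule norm_integral_le)
      show "(\<lambda>t. complex_of_real (q t)) absolutely_integrable_on {0..x}"
        by (rule absolutely_integrable_on_subinterval[OF qi]) (use x in auto)
      show "(\<lambda>t. \<phi> t / k * y t * of_real (q t)) integrable_on {0..x}"
        using aix[OF \<phi>(1) y(1) x] by (simp add: absolutely_integrable_on_def)
      fix t assume "t \<in> {0..x}"
      then have "norm (\<phi> t) * norm (y t) \<le> C * M"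
        using \<phi>(2)[of t] y(2)[of t] x C0 by (intro mult_mono) auto
      then have "norm (\<phi> t) * norm (y t) / norm k * norm (complex_of_real (q t))
          \<le> C * M / norm k * norm (complex_of_real (q t))"
        by (intro mult_right_mono divide_right_mono) auto
      then show "norm (\<phi> t / k * y t * of_real (q t)) \<le> C * M / norm k * norm (complex_of_real (q t))"
        by (simp add: norm_mult norm_divide)
    qed
    also have "\<dots> \<le> C * M / norm k * N"
    proof (intro mult_left_mono)
      have "(\<lambda>t. \<bar>q t\<bar>) integrable_on {0..l}"
        using L2_on_Ioo_absolutely_integrable(1)[OF q] by (simp add: absolutely_integrable_on_def)
      moreover from this have "(\<lambda>t. \<bar>q t\<bar>) integrable_on {0..x}"
        using x integrable_on_subinterval by fastforce
      ultimately show "integral {0..x} (\<lambda>t. norm (complex_of_real (q t))) \<le> N"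
        unfolding N_def norm_of_real using x by (intro integral_subset_le) auto
    qed (use C0 M0 in auto)
    finally show ?thesis .
  qed
  \<comment> \<open>The equation as a fixed point problem: the brackets are the varying coefficients
    \<open>p\<close> and \<open>r\<close>, and \<open>I\<close> collects the influence of the
    potential, with a factor \<open>1 / k\<close>.\<close>
  define T where "T y x = cs x * (a - I sn y x) + sn x * (b + I cs y x)" for y x
  \<comment> \<open>The lower bound on \<open>norm k\<close> is tuned to give contraction constant
    \<open>1 / 2\<close>. The same estimate yields the a priori bound on \<open>y\<close>
    below.\<close>
  have small: "C * (C * M / norm k * N) + C * (C * M / norm k * N) \<le> M / 2" if "M \<ge> 0" for M
  proof -
    have "4 * C\<^sup>2 * N * M \<le> norm k * M" using k(2) that by (intro mult_right_mono) (auto simp: N_def)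
    then show ?thesis using k(1) by (simp add: field_simps power2_eq_square)
  qed
  have bound2: "norm (cs x * u + sn x * v) \<le> C * m + C * m" if "x \<in> {0..l}" "norm u \<le> m" "norm v \<le> m" for x u v m
    using C'[OF that(1)] that C0
    by (intro norm_triangle_mono) (auto simp: norm_mult intro!: mult_mono)
  have "\<exists>y. continuous_on {0..l} y \<and> (\<forall>x\<in>{0..l}. y x = T y x)"
  proof (rule continuous_contraction_fixpoint)
    fix y :: "real \<Rightarrow> complex" assume y: "continuous_on {0..l} y"
    show "continuous_on {0..l} (T y)"
      unfolding T_def by (intro continuous_intros contcs contsn contI y)
    fix z :: "real \<Rightarrow> complex" and M x assume z: "continuous_on {0..l} z" and M: "\<And>t. t \<in> {0..l} \<Longrightarrow> norm (y t - z t) \<le> M"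
      and x: "x \<in> {0..l}"
    let ?d = "\<lambda>t. y t - z t"
    have M0: "M \<ge> 0" using M[OF x] norm_ge_zero order_trans by blast
    have d: "continuous_on {0..l} ?d" by (intro continuous_intros y z)
    have "T y x - T z x = cs x * (- (I sn y x - I sn z x)) + sn x * (I cs y x - I cs z x)"
      unfolding T_def by (simp add: algebra_simps)
    also have "norm \<dots> \<le> C * (C * M / norm k * N) + C * (C * M / norm k * N)"
      unfolding Idiff[OF contsn y z x] Idiff[OF contcs y z x]
      using Ile[OF contsn C'(2) d M x] Ile[OF contcs C'(1) d M x] by (intro bound2 x) auto
    finally show "norm (T y x - T z x) \<le> M / 2" using small[OF M0] by linarith
  qed (use l in simp)
  then obtain y where y: "continuous_on {0..l} y" and yT: "\<And>x. x \<in> {0..l} \<Longrightarrow> y x = T y x" by blast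
  obtain x0 where x0: "x0 \<in> {0..l}" "\<And>x. x \<in> {0..l} \<Longrightarrow> norm (y x) \<le> norm (y x0)"
    using continuous_attains_sup[OF compact_Icc _ continuous_on_norm[OF y]] l by auto
  define M where "M = norm (y x0)"
  have M: "norm (y x) \<le> M" if "x \<in> {0..l}" for x using x0(2)[OF that] by (simp add: M_def)
  \<comment> \<open>At a maximum point of the modulus the integral terms amount to at most
    \<open>M / 2\<close>, which is absorbed on the left.\<close>
  have "norm (y x0) \<le> norm (cs x0 * a + sn x0 * b) + norm (cs x0 * (- I sn y x0) + sn x0 * I cs y x0)"
    unfolding yT[OF x0(1)] T_def by (rule order_trans[OF _ norm_triangle_ineq]) (simp add: algebra_simps)
  also have "norm (cs x0 * (- I sn y x0) + sn x0 * I cs y x0) \<le> C * (C * M / norm k * N) + C * (C * M / norm k * N)"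
    using Ile[OF contsn C'(2) y M x0(1)] Ile[OF contcs C'(1) y M x0(1)] by (intro bound2 x0) auto
  also have "\<dots> \<le> M / 2" by (rule small) (simp add: M_def)
  also have "norm (cs x0 * a + sn x0 * b) \<le> C * norm a + C * norm b"
    using C'[OF x0(1)] by (intro norm_triangle_mono) (auto simp: norm_mult intro!: mult_right_mono)
  finally have Mle: "M \<le> 2 * C * (norm a + norm b)" by (simp add: M_def algebra_simps)
  define p where "p x = a - I sn y x" for x
  define r where "r x = b + I cs y x" for x
  have p0: "p 0 = a" and r0: "r 0 = b" by (simp_all add: p_def r_def I_def)
  have contp: "continuous_on {0..l} p" and contr: "continuous_on {0..l} r"
    unfolding p_def r_def by (intro continuous_intros contI contcs contsn y)+
  have \<epsilon>: "C * M / norm k * N \<le> \<epsilon>"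
  proof -
    have "(C * N / norm k) * M \<le> (C * N / norm k) * (2 * C * (norm a + norm b))"
      using Mle C0 N0 by (intro mult_left_mono) auto
    then show ?thesis unfolding \<epsilon>_def N_def[symmetric] by (simp add: power2_eq_square field_simps)
  qed
  have l': "l \<in> {0..l}" using l by simp
  have pl: "norm (p l - a) \<le> \<epsilon>" and rl: "norm (r l - b) \<le> \<epsilon>"
    using Ile[OF contsn C'(2) y M l'] Ile[OF contcs C'(1) y M l'] \<epsilon> by (auto simp: p_def r_def)
  \<comment> \<open>The densities of \<open>p\<close> and \<open>r\<close> satisfy
    \<open>f1 cs + f2 sn = 0\<close>. Hence the potential drops out of the first derivative
    \<open>g\<close> and enters only the second one, through \<open>cs^2 + sn^2 = 1\<close>.\<close>
  define f1 where "f1 t = - sn t / k * y t * of_real (q t)" for t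
  define f2 where "f2 t = cs t / k * y t * of_real (q t)" for t
  have f1: "f1 absolutely_integrable_on {0..l}"
    unfolding f1_def by (rule ai[OF continuous_on_minus[OF contsn] y])
  have f2: "f2 absolutely_integrable_on {0..l}"
    unfolding f2_def by (rule ai[OF contcs y])
  have pG: "p x = p 0 + integral {0..x} f1" for x
    by (simp add: p0 p_def I_def f1_def[abs_def])
  have rG: "r x = r 0 + integral {0..x} f2" for x
    by (simp add: r0 r_def I_def f2_def[abs_def])
  define g where "g t = k * (cs t * r t - sn t * p t)" for t
  define h where "h t = of_real (q t) * y t - k\<^sup>2 * y t" for t
  have yeq: "y x = cs x * p x + sn x * r x" if "x \<in> {0..l}" for x
    using yT[OF that] by (simp add: T_def p_def r_def)
  have ksn: "continuous_on {0..l} (\<lambda>x. - k * sn x)" and kcs: "continuous_on {0..l} (\<lambda>x. k * cs x)"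
    by (intro continuous_intros contcs contsn)+
  have contg: "continuous_on {0..l} g"
    unfolding g_def by (intro continuous_intros contcs contsn contp contr)
  have yg: "(g has_integral y x - y 0) {0..x}" if x: "x \<in> {0..l}" for x
  proof -
    have "((\<lambda>t. (f1 t * cs t + p t * (- k * sn t)) + (f2 t * sn t + r t * (k * cs t))) has_integral
        (p x * cs x - p 0 * cs 0) + (r x * sn x - r 0 * sn 0)) {0..x}"
      by (intro has_integral_add indefinite_integral_mult[OF f1 cs' ksn pG x]
          indefinite_integral_mult[OF f2 sn' kcs rG x])
    moreover have "(f1 t * cs t + p t * (- k * sn t)) + (f2 t * sn t + r t * (k * cs t)) = g t" for t
      by (simp add: f1_def f2_def g_def algebra_simps)
    moreover have "(p x * cs x - p 0 * cs 0) + (r x * sn x - r 0 * sn 0) = y x - y 0"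
      using yeq[OF x] yeq[of 0] l by (simp add: cs0 sn0 algebra_simps)
    ultimately show ?thesis by simp
  qed
  have gh: "(h has_integral g x - g 0) {0..x}" if x: "x \<in> {0..l}" for x
  proof -
    have "((\<lambda>t. k * ((f2 t * cs t + r t * (- k * sn t)) - (f1 t * sn t + p t * (k * cs t)))) has_integral
        k * ((r x * cs x - r 0 * cs 0) - (p x * sn x - p 0 * sn 0))) {0..x}"
      by (intro has_integral_mult_right has_integral_diff indefinite_integral_mult[OF f1 sn' kcs pG x]
          indefinite_integral_mult[OF f2 cs' ksn rG x])
    moreover have "k * ((f2 t * cs t + r t * (- k * sn t)) - (f1 t * sn t + p t * (k * cs t))) = h t"
      if "t \<in> {0..x}" for t
    proof -
      have t: "t \<in> {0..l}" using x that by auto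
      have "k * ((f2 t * cs t + r t * (- k * sn t)) - (f1 t * sn t + p t * (k * cs t))) =
          y t * of_real (q t) * ((cs t)\<^sup>2 + (sn t)\<^sup>2) - k\<^sup>2 * (cs t * p t + sn t * r t)"
        using k(1) by (simp add: f1_def f2_def field_simps power2_eq_square)
      also have "(cs t)\<^sup>2 + (sn t)\<^sup>2 = 1" by (simp add: cs_def sn_def)
      finally show ?thesis by (simp add: h_def yeq[OF t] mult.commute)
    qed
    moreover have "k * ((r x * cs x - r 0 * cs 0) - (p x * sn x - p 0 * sn 0)) = g x - g 0"
      by (simp add: g_def cs0 sn0 algebra_simps)
    ultimately show ?thesis by (metis (no_types, lifting) has_integral_eq)
  qed
  have hi: "h absolutely_integrable_on {0..l}"
  proof -
    have "(\<lambda>t. k\<^sup>2 * y t) absolutely_integrable_on {0..l}"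
      by (intro absolutely_integrable_continuous_real continuous_intros y)
    from set_integral_diff(1)[OF absolutely_integrable_on_mult_continuous[OF qi y] this]
    show ?thesis by (simp add: h_def[abs_def] mult.commute)
  qed
  have hL2: "L2_on {0..l} h"
  proof (rule L2_on_bounded)
    show "h \<in> borel_measurable (lebesgue_on {0..l})"
      using absolutely_integrable_imp_borel_measurable[OF hi] by simp
    have "(\<lambda>t. (q t)\<^sup>2) integrable_on {0..l}"
      using L2_on_Ioo_absolutely_integrable(2)[OF q] by (simp add: absolutely_integrable_on_def)
    then show "(\<lambda>t. 2 * M\<^sup>2 * (q t)\<^sup>2 + 2 * M\<^sup>2 * (norm (k\<^sup>2))\<^sup>2) integrable_on {0..l}"
      by (intro integrable_add integrable_on_mult_right) auto
    fix t assume t: "t \<in> {0..l}"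
    have "h t = (of_real (q t) - k\<^sup>2) * y t" by (simp add: h_def algebra_simps)
    then have "norm (h t) \<le> (\<bar>q t\<bar> + norm (k\<^sup>2)) * M"
      unfolding norm_mult using M[OF t] norm_triangle_ineq4[of "of_real (q t)" "k\<^sup>2"]
      by (simp add: norm_mult) (intro mult_mono; simp)
    then have "(norm (h t))\<^sup>2 \<le> ((\<bar>q t\<bar> + norm (k\<^sup>2)) * M)\<^sup>2"
      by (rule power_mono) simp
    also have "\<dots> \<le> 2 * (\<bar>q t\<bar>\<^sup>2 + (norm (k\<^sup>2))\<^sup>2) * M\<^sup>2"
      unfolding power_mult_distrib using sum_squares_bound[of "\<bar>q t\<bar>" "norm (k\<^sup>2)"]
      by (intro mult_right_mono) (auto simp: power2_sum)
    finally show "(norm (h t))\<^sup>2 \<le> 2 * M\<^sup>2 * (q t)\<^sup>2 + 2 * M\<^sup>2 * (norm (k\<^sup>2))\<^sup>2"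
      by (simp add: algebra_simps)
  qed
  have "schroedinger {0..l} q (k\<^sup>2) y"
    unfolding schroedinger_def
  proof (intro exI conjI)
    show "H1_deriv {0..l} y g"
      using contg by (intro H1_derivI yg absolutely_integrable_continuous_real L2_on_continuous)
    show "H1_deriv {0..l} g h" by (intro H1_derivI gh hi hL2)
    show "AE x in lebesgue. x \<in> {0..l} \<longrightarrow> - h x + of_real (q x) * y x = k\<^sup>2 * y x"
      by (simp add: h_def)
  qed
  moreover have "(y has_vector_derivative g x) (at x within {0..l})" if x: "x \<in> {0..l}" for x
  proof (rule has_vector_derivative_transform[OF x])
    show "y u = y 0 + integral {0..u} g" if "u \<in> {0..l}" for u
      using yg[OF that] by (simp add: has_integral_iff)
    show "((\<lambda>u. y 0 + integral {0..u} g) has_vector_derivative g x) (at x within {0..l})"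
      using integral_has_vector_derivative[OF contg x] by (auto intro!: derivative_eq_intros)
  qed
  from this[of 0] this[of l] have "(y has_vector_derivative k * b) (at 0 within {0..l})"
    "(y has_vector_derivative k * (cs l * r l - sn l * p l)) (at l within {0..l})"
    using l by (simp_all add: g_def cs0 sn0 r0)
  moreover have "y 0 = a" "y l = cs l * p l + sn l * r l"
    using yeq[of 0] yeq[of l] l by (simp_all add: cs0 sn0 p0)
  ultimately show ?thesis
    using pl rl unfolding cs_def sn_def by blast
qed

section \<open>Linearity of the equation\<close>

lemma L2_on_lincomb:
  fixes f g :: "real \<Rightarrow> complex"
  assumes S: "S \<in> sets lebesgue" and "L2_on S f" "L2_on S g"
  shows "L2_on S (\<lambda>x. \<alpha> * f x + \<beta> * g x)"
proof -
  have m: "f \<in> borel_measurable (lebesgue_on S)" "g \<in> borel_measurable (lebesgue_on S)"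
    and i: "(\<lambda>x. (norm (f x))\<^sup>2) integrable_on S" "(\<lambda>x. (norm (g x))\<^sup>2) integrable_on S"
    using assms by (simp_all add: L2_on_iff_measurable absolutely_integrable_on_def)
  have "(\<lambda>x. (norm (\<alpha> * f x + \<beta> * g x))\<^sup>2) absolutely_integrable_on S"
  proof (rule measurable_bounded_by_integrable_imp_absolutely_integrable[OF _ S])
    show "(\<lambda>x. (norm (\<alpha> * f x + \<beta> * g x))\<^sup>2) \<in> borel_measurable (lebesgue_on S)"
      using m by measurable
    show "(\<lambda>x. 2 * (norm \<alpha>)\<^sup>2 * (norm (f x))\<^sup>2 + 2 * (norm \<beta>)\<^sup>2 * (norm (g x))\<^sup>2) integrable_on S"
      by (intro integrable_add integrable_on_mult_right i)
    fix x
    have "(norm (\<alpha> * f x + \<beta> * g x))\<^sup>2 \<le> (norm \<alpha> * norm (f x) + norm \<beta> * norm (g x))\<^sup>2"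
      by (intro power_mono order_trans[OF norm_triangle_ineq]) (auto simp: norm_mult)
    also have "\<dots> \<le> 2 * (norm \<alpha> * norm (f x))\<^sup>2 + 2 * (norm \<beta> * norm (g x))\<^sup>2"
      using sum_squares_bound[of "norm \<alpha> * norm (f x)" "norm \<beta> * norm (g x)"] by (simp add: power2_sum)
    finally show "norm ((norm (\<alpha> * f x + \<beta> * g x))\<^sup>2)
        \<le> 2 * (norm \<alpha>)\<^sup>2 * (norm (f x))\<^sup>2 + 2 * (norm \<beta>)\<^sup>2 * (norm (g x))\<^sup>2"
      by (simp add: power_mult_distrib)
  qed
  then show ?thesis using m S by (simp add: L2_on_iff_measurable)
qed

lemma H1_deriv_lincomb:
  assumes "H1_deriv {c..d} f f'" "H1_deriv {c..d} g g'"
  shows "H1_deriv {c..d} (\<lambda>x. \<alpha> * f x + \<beta> * g x) (\<lambda>x. \<alpha> * f' x + \<beta> * g' x)"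
  unfolding H1_deriv_def
proof (intro conjI ballI impI)
  show "L2_on {c..d} (\<lambda>x. \<alpha> * f x + \<beta> * g x)" "L2_on {c..d} (\<lambda>x. \<alpha> * f' x + \<beta> * g' x)"
    using assms by (auto simp: H1_deriv_def intro!: L2_on_lincomb)
  fix a b assume ab: "a \<in> {c..d}" "b \<in> {c..d}" "a \<le> b"
  have int: "h absolutely_integrable_on {a..b}" if "L2_on {c..d} h" for h :: "real \<Rightarrow> complex"
    by (rule absolutely_integrable_on_subinterval[OF L2_on_imp_absolutely_integrable(1)[OF that]]) (use ab in auto)
  have i: "f' absolutely_integrable_on {a..b}" "g' absolutely_integrable_on {a..b}"
    using assms by (auto simp: H1_deriv_def intro: int)
  have "(LINT t:{a..b}|lebesgue. \<alpha> * f' t + \<beta> * g' t) =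
      \<alpha> * (LINT t:{a..b}|lebesgue. f' t) + \<beta> * (LINT t:{a..b}|lebesgue. g' t)"
    using i by (simp add: set_integral_add)
  also have "\<dots> = \<alpha> * (f b - f a) + \<beta> * (g b - g a)"
    using assms ab by (simp add: H1_deriv_def)
  finally show "\<alpha> * f b + \<beta> * g b - (\<alpha> * f a + \<beta> * g a) = (LINT t:{a..b}|lebesgue. \<alpha> * f' t + \<beta> * g' t)"
    by (simp add: algebra_simps)
qed

lemma schroedinger_lincomb:
  assumes "schroedinger {c..d} q \<mu> f" "schroedinger {c..d} q \<mu> g"
  shows "schroedinger {c..d} q \<mu> (\<lambda>x. \<alpha> * f x + \<beta> * g x)"
proof -
  obtain f1 f2 where f: "H1_deriv {c..d} f f1" "H1_deriv {c..d} f1 f2"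
      "AE x in lebesgue. x \<in> {c..d} \<longrightarrow> - f2 x + of_real (q x) * f x = \<mu> * f x"
    using assms(1) by (auto simp: schroedinger_def)
  obtain g1 g2 where g: "H1_deriv {c..d} g g1" "H1_deriv {c..d} g1 g2"
      "AE x in lebesgue. x \<in> {c..d} \<longrightarrow> - g2 x + of_real (q x) * g x = \<mu> * g x"
    using assms(2) by (auto simp: schroedinger_def)
  have "AE x in lebesgue. x \<in> {c..d} \<longrightarrow> - (\<alpha> * f2 x + \<beta> * g2 x) +
      of_real (q x) * (\<alpha> * f x + \<beta> * g x) = \<mu> * (\<alpha> * f x + \<beta> * g x)"
    using f(3) g(3)
  proof eventually_elim
    case (elim x)
    show ?case
    proof
      assume "x \<in> {c..d}"
      then have "\<alpha> * (- f2 x + of_real (q x) * f x) + \<beta> * (- g2 x + of_real (q x) * g x) = \<alpha> * (\<mu> * f x) + \<beta> * (\<mu> * g x)"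
        using elim by simp
      then show "- (\<alpha> * f2 x + \<beta> * g2 x) + of_real (q x) * (\<alpha> * f x + \<beta> * g x) = \<mu> * (\<alpha> * f x + \<beta> * g x)"
        by (simp add: algebra_simps)
    qed
  qed
  then show ?thesis
    unfolding schroedinger_def using H1_deriv_lincomb[OF f(1) g(1)] H1_deriv_lincomb[OF f(2) g(2)] by blast
qed

corollary schroedinger_scale:
  "schroedinger {c..d} q \<mu> f \<Longrightarrow> schroedinger {c..d} q \<mu> (\<lambda>x. \<alpha> * f x)"
  using schroedinger_lincomb[of c d q \<mu> f f \<alpha> 0] by simp

section \<open>Transfer across an edge as k tends to infinity\<close>

lemma norm_cos_sin_le_exp_Im: "norm (cos z) \<le> exp \<bar>Im z\<bar>" "norm (sin z) \<le> exp \<bar>Im z\<bar>"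
proof -
  have n: "norm (exp (\<i> * z)) \<le> exp \<bar>Im z\<bar>" "norm (exp (- (\<i> * z))) \<le> exp \<bar>Im z\<bar>"
    by (auto simp: norm_exp_eq_Re)
  have "norm (exp (\<i> * z) + exp (- (\<i> * z))) \<le> 2 * exp \<bar>Im z\<bar>"
       "norm (exp (\<i> * z) - exp (- (\<i> * z))) \<le> 2 * exp \<bar>Im z\<bar>"
    using n norm_triangle_ineq[of "exp (\<i> * z)" "exp (- (\<i> * z))"]
      norm_triangle_ineq4[of "exp (\<i> * z)" "exp (- (\<i> * z))"] by linarith+
  then show "norm (cos z) \<le> exp \<bar>Im z\<bar>" "norm (sin z) \<le> exp \<bar>Im z\<bar>"
    by (simp_all add: cos_exp_eq sin_exp_eq norm_divide norm_mult)
qed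

text \<open>Bounded imaginary parts bound \<open>cos (k x)\<close> and \<open>sin (k x)\<close>
  uniformly on the edge, growing \<open>norm (k n)\<close> suppresses the potential, and
  \<open>c\<close>, \<open>s\<close> are the entries of the limiting transfer matrix.\<close>

locale quasi_momenta =
  fixes l :: real and k :: "nat \<Rightarrow> complex" and c s :: complex
  assumes l_pos: "l > 0"
    and k_infinity: "filterlim (\<lambda>n. norm (k n)) at_top sequentially"
    and Im_k_bounded: "\<exists>K. \<forall>n. \<bar>Im (k n)\<bar> \<le> K"
    and cos_limit: "(\<lambda>n. cos (k n * of_real l)) \<longlonglongrightarrow> c"
    and sin_limit: "(\<lambda>n. sin (k n * of_real l)) \<longlonglongrightarrow> s"
begin

lemma pythagoras: "c\<^sup>2 + s\<^sup>2 = 1"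
proof -
  have "(\<lambda>n. (cos (k n * of_real l))\<^sup>2 + (sin (k n * of_real l))\<^sup>2) \<longlonglongrightarrow> c\<^sup>2 + s\<^sup>2"
    by (intro tendsto_intros cos_limit sin_limit)
  then show ?thesis by (simp add: LIMSEQ_const_iff)
qed

lemma k_nonzero: "\<forall>\<^sub>F n in sequentially. k n \<noteq> 0"
  using k_infinity by (auto simp: filterlim_at_top_dense elim!: eventually_mono allE[of _ 0])

text \<open>Cauchy data at both ends, with derivatives divided by \<open>k n\<close> so that they
  have finite limits.\<close>

definition solution_data ::
    "(real \<Rightarrow> real) \<Rightarrow> nat \<Rightarrow> (real \<Rightarrow> complex) \<Rightarrow> complex \<Rightarrow> complex \<Rightarrow> complex \<Rightarrow> complex \<Rightarrow> bool" where
  "solution_data q n y a b a' b' \<longleftrightarrow> schroedinger {0..l} q ((k n)\<^sup>2) y \<and>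
     y 0 = a \<and> (y has_vector_derivative k n * b) (at 0 within {0..l}) \<and>
     y l = a' \<and> (y has_vector_derivative k n * b') (at l within {0..l})"

lemma solution_data_lincomb:
  assumes "solution_data q n f a\<^sub>1 b\<^sub>1 a\<^sub>1' b\<^sub>1'" "solution_data q n g a\<^sub>2 b\<^sub>2 a\<^sub>2' b\<^sub>2'"
  shows "solution_data q n (\<lambda>x. \<alpha> * f x + \<beta> * g x)
    (\<alpha> * a\<^sub>1 + \<beta> * a\<^sub>2) (\<alpha> * b\<^sub>1 + \<beta> * b\<^sub>2) (\<alpha> * a\<^sub>1' + \<beta> * a\<^sub>2') (\<alpha> * b\<^sub>1' + \<beta> * b\<^sub>2')"
proof -
  have e: "k n * (\<alpha> * u + \<beta> * v) = \<alpha> * (k n * u) + \<beta> * (k n * v)" for u v by (simp add: algebra_simps)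
  show ?thesis using assms unfolding solution_data_def e
    by (auto intro!: schroedinger_lincomb derivative_intros)
qed

text \<open>The coefficients \<open>p n\<close> and \<open>r n\<close> at the right end differ from
  \<open>a\<close> and \<open>b\<close> by a multiple of \<open>1 / norm (k n)\<close>, so the data
  there approach those of the free solution.\<close>

lemma solution_from_left:
  assumes q: "L2_on {0<..<l} q"
  shows "\<exists>y A B. (\<forall>\<^sub>F n in sequentially. solution_data q n (y n) a b (A n) (B n)) \<and>
    A \<longlonglongrightarrow> c * a + s * b \<and> B \<longlonglongrightarrow> c * b - s * a"
proof -
  obtain K where K: "\<And>n. \<bar>Im (k n)\<bar> \<le> K" using Im_k_bounded by blast
  define C where "C = exp (K * l)"
  define N where "N = integral {0..l} (\<lambda>t. \<bar>q t\<bar>)"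
  define \<epsilon> where "\<epsilon> n = 2 * C\<^sup>2 * N * (norm a + norm b) / norm (k n)" for n
  have C: "norm (cos (k n * of_real x)) \<le> C" "norm (sin (k n * of_real x)) \<le> C" if "x \<in> {0..l}" for n x
  proof -
    have "\<bar>Im (k n * of_real x)\<bar> = \<bar>Im (k n)\<bar> * x" using that by (simp add: abs_mult)
    also have "\<dots> \<le> K * l" using K[of n] that by (intro mult_mono) auto
    finally have "exp \<bar>Im (k n * of_real x)\<bar> \<le> C" by (simp add: C_def)
    then show "norm (cos (k n * of_real x)) \<le> C" "norm (sin (k n * of_real x)) \<le> C"
      using norm_cos_sin_le_exp_Im order_trans by blast+
  qed
  let ?P = "\<lambda>n y p r. schroedinger {0..l} q ((k n)\<^sup>2) y \<and>
    y 0 = a \<and> (y has_vector_derivative k n * b) (at 0 within {0..l}) \<and>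
    y l = cos (k n * of_real l) * p + sin (k n * of_real l) * r \<and>
    (y has_vector_derivative k n * (cos (k n * of_real l) * r - sin (k n * of_real l) * p)) (at l within {0..l}) \<and>
    norm (p - a) \<le> \<epsilon> n \<and> norm (r - b) \<le> \<epsilon> n"
  have "\<forall>\<^sub>F n in sequentially. 4 * C\<^sup>2 * N \<le> norm (k n)"
    using k_infinity by (simp add: filterlim_at_top)
  then have "\<forall>\<^sub>F n in sequentially. \<exists>y p r. ?P n y p r"
    using k_nonzero
  proof eventually_elim
    case (elim n)
    show ?case unfolding \<epsilon>_def N_def
      by (rule schroedinger_solution_exists[OF l_pos q C elim(2)]) (use elim(1) N_def in auto)
  qed
  then obtain y p r where P: "\<forall>\<^sub>F n in sequentially. ?P n (y n) (p n) (r n)"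
    unfolding eventually_ex by blast
  have "\<epsilon> \<longlonglongrightarrow> 0"
    unfolding \<epsilon>_def using filterlim_at_top_imp_at_infinity[OF k_infinity]
    by (intro tendsto_divide_0[OF tendsto_const])
  then have "(\<lambda>n. p n - a) \<longlonglongrightarrow> 0" "(\<lambda>n. r n - b) \<longlonglongrightarrow> 0"
    using P by (auto elim!: Lim_null_comparison[rotated] eventually_mono)
  then have pr: "p \<longlonglongrightarrow> a" "r \<longlonglongrightarrow> b" by (simp_all add: LIM_zero_iff)
  show ?thesis
  proof (intro exI conjI)
    show "\<forall>\<^sub>F n in sequentially. solution_data q n (y n) a b
        (cos (k n * of_real l) * p n + sin (k n * of_real l) * r n)
        (cos (k n * of_real l) * r n - sin (k n * of_real l) * p n)"
      using P by eventually_elim (simp add: solution_data_def)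
  qed (intro tendsto_intros cos_limit sin_limit pr)+
qed

lemma fundamental_system:
  assumes q: "L2_on {0<..<l} q"
  obtains y z A B C D where
    "\<forall>\<^sub>F n in sequentially. solution_data q n (y n) 1 0 (A n) (B n) \<and> solution_data q n (z n) 0 1 (C n) (D n)"
    "A \<longlonglongrightarrow> c" "B \<longlonglongrightarrow> - s" "C \<longlonglongrightarrow> s" "D \<longlonglongrightarrow> c"
proof -
  obtain y A B where y: "\<forall>\<^sub>F n in sequentially. solution_data q n (y n) 1 0 (A n) (B n)"
      "A \<longlonglongrightarrow> c" "B \<longlonglongrightarrow> - s"
    using solution_from_left[OF q, of 1 0] by auto
  obtain z C D where z: "\<forall>\<^sub>F n in sequentially. solution_data q n (z n) 0 1 (C n) (D n)"
      "C \<longlonglongrightarrow> s" "D \<longlonglongrightarrow> c"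
    using solution_from_left[OF q, of 0 1] by auto
  show ?thesis
    by (rule that[OF eventually_conj[OF y(1) z(1)] y(2,3) z(2,3)])
qed

text \<open>The slope of a branch varies with \<open>n\<close>, while
  \<open>solution_from_left\<close> takes fixed data; the two fundamental solutions are therefore
  combined with coefficients depending on \<open>n\<close>.\<close>

lemma solution_with_left_data:
  assumes q: "L2_on {0<..<l} q" and b: "b \<longlonglongrightarrow> b0"
  shows "\<exists>y A B. (\<forall>\<^sub>F n in sequentially. solution_data q n (y n) 1 (b n) (A n) (B n)) \<and>
    A \<longlonglongrightarrow> c + s * b0 \<and> B \<longlonglongrightarrow> c * b0 - s"
proof -
  obtain y z A B C D where f:
    "\<forall>\<^sub>F n in sequentially. solution_data q n (y n) 1 0 (A n) (B n) \<and> solution_data q n (z n) 0 1 (C n) (D n)"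
    and lim: "A \<longlonglongrightarrow> c" "B \<longlonglongrightarrow> - s" "C \<longlonglongrightarrow> s" "D \<longlonglongrightarrow> c"
    by (rule fundamental_system[OF q])
  show ?thesis
  proof (intro exI conjI)
    show "\<forall>\<^sub>F n in sequentially. solution_data q n (\<lambda>x. 1 * y n x + b n * z n x) 1 (b n) (A n + b n * C n) (B n + b n * D n)"
      using f
    proof eventually_elim
      case (elim n)
      show ?case
        using solution_data_lincomb[OF elim[THEN conjunct1] elim[THEN conjunct2], of 1 "b n"] by simp
    qed
    have "(\<lambda>n. A n + b n * C n) \<longlonglongrightarrow> c + b0 * s" "(\<lambda>n. B n + b n * D n) \<longlonglongrightarrow> - s + b0 * c"
      by (intro tendsto_intros lim b)+
    then show "(\<lambda>n. A n + b n * C n) \<longlonglongrightarrow> c + s * b0" "(\<lambda>n. B n + b n * D n) \<longlonglongrightarrow> c * b0 - s"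
      by (simp_all add: algebra_simps)
  qed
qed

text \<open>The transfer matrix is inverted for the case in which the branch hangs at the right end
  of its edge. Its determinant \<open>W\<close> tends to \<open>1\<close> by
  \<open>pythagoras\<close>, hence is nonzero for large \<open>n\<close>.\<close>

lemma solution_with_right_data:
  assumes q: "L2_on {0<..<l} q" and b: "b \<longlonglongrightarrow> b0"
  shows "\<exists>y A B. (\<forall>\<^sub>F n in sequentially. solution_data q n (y n) (A n) (B n) 1 (b n)) \<and>
    A \<longlonglongrightarrow> c - s * b0 \<and> B \<longlonglongrightarrow> s + c * b0"
proof -
  obtain y z A B C D where f:
    "\<forall>\<^sub>F n in sequentially. solution_data q n (y n) 1 0 (A n) (B n) \<and> solution_data q n (z n) 0 1 (C n) (D n)"
    and lim: "A \<longlonglongrightarrow> c" "B \<longlonglongrightarrow> - s" "C \<longlonglongrightarrow> s" "D \<longlonglongrightarrow> c"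
    by (rule fundamental_system[OF q])
  define W where "W n = A n * D n - B n * C n" for n
  have W: "W \<longlonglongrightarrow> 1"
  proof -
    have "W \<longlonglongrightarrow> c * c - (- s) * s" unfolding W_def by (intro tendsto_intros lim)
    then show ?thesis using pythagoras by (simp add: power2_eq_square)
  qed
  then have W0: "\<forall>\<^sub>F n in sequentially. W n \<noteq> 0"
    by (rule tendsto_imp_eventually_ne) simp
  define \<alpha> where "\<alpha> n = (D n - C n * b n) / W n" for n
  define \<beta> where "\<beta> n = (A n * b n - B n) / W n" for n
  show ?thesis
  proof (intro exI conjI)
    show "\<forall>\<^sub>F n in sequentially. solution_data q n (\<lambda>x. \<alpha> n * y n x + \<beta> n * z n x) (\<alpha> n) (\<beta> n) 1 (b n)"
      using f W0
    proof eventually_elim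
      case (elim n)
      have "\<alpha> n * A n + \<beta> n * C n = W n / W n" "\<alpha> n * B n + \<beta> n * D n = (W n * b n) / W n"
        unfolding \<alpha>_def \<beta>_def times_divide_eq_left add_divide_distrib[symmetric]
        by (rule arg_cong[where f = "\<lambda>x. x / W n"]; simp add: W_def algebra_simps)+
      then have "\<alpha> n * A n + \<beta> n * C n = 1" "\<alpha> n * B n + \<beta> n * D n = b n"
        using elim(2) by simp_all
      then show ?case
        using solution_data_lincomb[OF elim(1)[THEN conjunct1] elim(1)[THEN conjunct2], of "\<alpha> n" "\<beta> n"] by simp
    qed
    have "\<alpha> \<longlonglongrightarrow> (c - s * b0) / 1" "\<beta> \<longlonglongrightarrow> (c * b0 - (- s)) / 1"
      unfolding \<alpha>_def \<beta>_def by (intro tendsto_intros lim b W; simp)+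
    then show "\<alpha> \<longlonglongrightarrow> c - s * b0" "\<beta> \<longlonglongrightarrow> s + c * b0" by (simp_all add: add.commute)
  qed
qed

end


section \<open>Finite trees as rooted trees\<close>

text \<open>A relation, because the order of grafting is free and one graph has several terms. The
  joining edge may be listed in either orientation.\<close>

inductive rooted :: "'v set \<Rightarrow> ('v \<times> 'v) set \<Rightarrow> 'v \<Rightarrow> btree \<Rightarrow> bool" where
  rooted_Leaf: "rooted {v} {} v Leaf"
| rooted_Graft: "rooted V E v s \<Longrightarrow> rooted W F w t \<Longrightarrow> V \<inter> W = {} \<Longrightarrow> e = (v, w) \<or> e = (w, v) \<Longrightarrow>
    rooted (V \<union> W) (insert e (E \<union> F)) v (Graft t s)"

inductive_cases rooted_LeafE: "rooted V E v Leaf"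
inductive_cases rooted_GraftE: "rooted V E v (Graft t s)"

lemma rooted_facts:
  assumes "rooted V E v t"
  shows "finite V" "finite E" "v \<in> V" "E \<subseteq> V \<times> V" "card V = leaves t"
  using assms by (induction rule: rooted.induct) (auto simp: card_Un_disjoint)

text \<open>Attaching two branches at the same root in either order yields the same vertex and edge
  sets, so insertion may move \<open>t\<close> past heavier branches.\<close>

lemma rooted_sorted_graft:
  assumes "rooted V E v s" "rooted W F w t" "V \<inter> W = {}" "e = (v, w) \<or> e = (w, v)"
  shows "rooted (V \<union> W) (insert e (E \<union> F)) v (sorted_graft t s)"
  using assms(1,3)
proof (induction s arbitrary: V E rule: btree.induct)
  case Leaf
  then show ?case using rooted_Graft[OF _ assms(2) _ assms(4)] by simp
next
  case (Graft t' s)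
  show ?case
  proof (cases "weight t' \<le> weight t")
    case True
    then show ?thesis using rooted_Graft[OF Graft.prems(1) assms(2) Graft.prems(2) assms(4)] by simp
  next
    case False
    obtain V0 E0 W' F' w' e' where *: "V = V0 \<union> W'" "E = insert e' (E0 \<union> F')" "rooted V0 E0 v s"
        "rooted W' F' w' t'" "V0 \<inter> W' = {}" "e' = (v, w') \<or> e' = (w', v)"
      using Graft.prems(1) by (elim rooted_GraftE) blast
    have "rooted (V0 \<union> W) (insert e (E0 \<union> F)) v (sorted_graft t s)"
      using Graft.prems(2) * by (intro Graft.IH) auto
    then have "rooted ((V0 \<union> W) \<union> W') (insert e' (insert e (E0 \<union> F) \<union> F')) v (Graft t' (sorted_graft t s))"
      using Graft.prems(2) * by (intro rooted_Graft[where w = w']) auto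
    moreover have "(V0 \<union> W) \<union> W' = V \<union> W" "insert e' (insert e (E0 \<union> F) \<union> F') = insert e (E \<union> F)"
      using * by auto
    ultimately show ?thesis using False by simp
  qed
qed

text \<open>This is insertion sort of the branches at every vertex.\<close>

lemma rooted_descending:
  assumes "rooted V E v t"
  shows "\<exists>t'. descending t' \<and> rooted V E v t'"
  using assms
proof (induction rule: rooted.induct)
  case (rooted_Leaf v)
  then show ?case by (intro exI[of _ Leaf]) (simp add: rooted.rooted_Leaf)
next
  case (rooted_Graft V E v s W F w t e)
  then obtain s' t' where "descending s'" "rooted V E v s'" "descending t'" "rooted W F w t'" by blast
  then show ?case using rooted_Graft.hyps
    by (intro exI[of _ "sorted_graft t' s'"]) (auto intro: descending_sorted_graft rooted_sorted_graft)
qed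

text \<open>The bijections of the two parts are glued. The clause \<open>f v = v'\<close> carries
  the induction: the new edge joins the two roots, so both bijections have to respect them.\<close>

lemma rooted_isomorphic:
  assumes "rooted V E v t" "rooted V' E' v' t"
  shows "\<exists>f. bij_betw f V V' \<and> f v = v' \<and>
    (\<forall>a\<in>V. \<forall>b\<in>V. (a, b) \<in> adjacency E \<longleftrightarrow> (f a, f b) \<in> adjacency E')"
  using assms
proof (induction arbitrary: V' E' v' rule: rooted.induct)
  case (rooted_Leaf v)
  then show ?case
    by (elim rooted_LeafE) (auto simp: adjacency_def bij_betw_def)
next
  case (rooted_Graft V E v s W F w t e)
  obtain V0 E0 W' F' w' e' where *: "V' = V0 \<union> W'" "E' = insert e' (E0 \<union> F')" "rooted V0 E0 v' s"
      "rooted W' F' w' t" "V0 \<inter> W' = {}" "e' = (v', w') \<or> e' = (w', v')"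
    using rooted_Graft.prems(1) by (elim rooted_GraftE) blast
  obtain f where f: "bij_betw f V V0" "f v = v'"
      "\<And>a b. a \<in> V \<Longrightarrow> b \<in> V \<Longrightarrow> (a, b) \<in> adjacency E \<longleftrightarrow> (f a, f b) \<in> adjacency E0"
    using rooted_Graft.IH(1)[OF *(3)] by blast
  obtain g where g: "bij_betw g W W'" "g w = w'"
      "\<And>a b. a \<in> W \<Longrightarrow> b \<in> W \<Longrightarrow> (a, b) \<in> adjacency F \<longleftrightarrow> (g a, g b) \<in> adjacency F'"
    using rooted_Graft.IH(2)[OF *(4)] by blast
  define h where "h x = (if x \<in> V then f x else g x)" for x
  have hV: "h x = f x" if "x \<in> V" for x using that by (simp add: h_def)
  have hW: "h x = g x" if "x \<in> W" for x using that rooted_Graft.hyps by (auto simp: h_def)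
  have fV: "f x \<in> V0" if "x \<in> V" for x using that f(1) by (auto simp: bij_betw_def)
  have gW: "g x \<in> W'" if "x \<in> W" for x using that g(1) by (auto simp: bij_betw_def)
  have v: "v \<in> V" "v' \<in> V0" and w: "w \<in> W" "w' \<in> W'"
    using rooted_facts(3)[OF rooted_Graft.hyps(1)] rooted_facts(3)[OF rooted_Graft.hyps(2)]
      rooted_facts(3)[OF *(3)] rooted_facts(3)[OF *(4)] by simp_all
  have sub: "adjacency E \<subseteq> V \<times> V" "adjacency F \<subseteq> W \<times> W" "adjacency E0 \<subseteq> V0 \<times> V0" "adjacency F' \<subseteq> W' \<times> W'"
    using rooted_facts(4)[OF rooted_Graft.hyps(1)] rooted_facts(4)[OF rooted_Graft.hyps(2)]
      rooted_facts(4)[OF *(3)] rooted_facts(4)[OF *(4)] by (auto simp: adjacency_def)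
  have adj: "adjacency (insert e (E \<union> F)) = adjacency E \<union> adjacency F \<union> {(v, w), (w, v)}"
    using rooted_Graft.hyps(4) by (auto simp: adjacency_def)
  have adj': "adjacency E' = adjacency E0 \<union> adjacency F' \<union> {(v', w'), (w', v')}"
    using *(2,6) by (auto simp: adjacency_def)
  have inj: "f a = v' \<longleftrightarrow> a = v" if "a \<in> V" for a
    using f(1,2) v that by (auto simp: bij_betw_def inj_on_def)
  have inj': "g a = w' \<longleftrightarrow> a = w" if "a \<in> W" for a
    using g(1,2) w that by (auto simp: bij_betw_def inj_on_def)
  have "(a, b) \<in> adjacency (insert e (E \<union> F)) \<longleftrightarrow> (h a, h b) \<in> adjacency E'"
    if ab: "a \<in> V \<union> W" "b \<in> V \<union> W" for a b
  proof -
    consider "a \<in> V" "b \<in> V" | "a \<in> W" "b \<in> W" | "a \<in> V" "b \<in> W" | "a \<in> W" "b \<in> V" using ab by blast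
    then show ?thesis
    proof cases
      case 1
      moreover have "(a, b) \<notin> adjacency F \<union> {(v, w), (w, v)}"
        using 1 sub(2) w rooted_Graft.hyps(3) by blast
      moreover have "(f a, f b) \<notin> adjacency F' \<union> {(v', w'), (w', v')}"
        using fV[OF 1(1)] fV[OF 1(2)] sub(4) w *(5) by blast
      ultimately show ?thesis unfolding adj adj' hV[OF 1(1)] hV[OF 1(2)] using f(3)[OF 1] by blast
    next
      case 2
      moreover have "(a, b) \<notin> adjacency E \<union> {(v, w), (w, v)}"
        using 2 sub(1) v rooted_Graft.hyps(3) by blast
      moreover have "(g a, g b) \<notin> adjacency E0 \<union> {(v', w'), (w', v')}"
        using gW[OF 2(1)] gW[OF 2(2)] sub(3) v *(5) by blast
      ultimately show ?thesis unfolding adj adj' hW[OF 2(1)] hW[OF 2(2)] using g(3)[OF 2] by blast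
    next
      case 3
      moreover have "(a, b) \<notin> adjacency E \<union> adjacency F"
        using 3 sub rooted_Graft.hyps(3) by blast
      moreover have "(f a, g b) \<notin> adjacency E0 \<union> adjacency F'"
        using fV[OF 3(1)] gW[OF 3(2)] sub *(5) by blast
      moreover have "b \<noteq> v" "a \<noteq> w" "f a \<noteq> w'" "g b \<noteq> v'"
        using 3 v w fV[OF 3(1)] gW[OF 3(2)] *(5) rooted_Graft.hyps(3) by blast+
      ultimately show ?thesis unfolding adj adj' hV[OF 3(1)] hW[OF 3(2)]
        using inj[OF 3(1)] inj'[OF 3(2)] by blast
    next
      case 4
      moreover have "(a, b) \<notin> adjacency E \<union> adjacency F"
        using 4 sub rooted_Graft.hyps(3) by blast
      moreover have "(g a, f b) \<notin> adjacency E0 \<union> adjacency F'"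
        using fV[OF 4(2)] gW[OF 4(1)] sub *(5) by blast
      moreover have "a \<noteq> v" "b \<noteq> w" "f b \<noteq> w'" "g a \<noteq> v'"
        using 4 v w fV[OF 4(2)] gW[OF 4(1)] *(5) rooted_Graft.hyps(3) by blast+
      ultimately show ?thesis unfolding adj adj' hW[OF 4(1)] hV[OF 4(2)]
        using inj[OF 4(2)] inj'[OF 4(1)] by blast
    qed
  qed
  moreover have "bij_betw h (V \<union> W) V'"
    unfolding *(1)
  proof (rule bij_betw_combine[OF _ _ *(5)])
    show "bij_betw h V V0" using f(1) by (subst bij_betw_cong[OF hV]) auto
    show "bij_betw h W W'" using g(1) by (subst bij_betw_cong[OF hW]) auto
  qed
  moreover have "h v = v'" using v f(2) by (simp add: hV)
  ultimately show ?case by blast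
qed

section \<open>Splitting a finite tree at an edge\<close>

lemma rtrancl_distinct_path:
  assumes "(x, y) \<in> R\<^sup>*"
  shows "\<exists>p. p \<noteq> [] \<and> hd p = x \<and> last p = y \<and> distinct p \<and> successively (\<lambda>a b. (a, b) \<in> R) p"
  using assms
proof (induction rule: rtrancl_induct)
  case base
  show ?case by (intro exI[of _ "[x]"]) simp
next
  case (step y z)
  then obtain p where p: "p \<noteq> []" "hd p = x" "last p = y" "distinct p" "successively (\<lambda>a b. (a, b) \<in> R) p"
    by blast
  show ?case
  proof (cases "z \<in> set p")
    case True
    then obtain as bs where "p = as @ z # bs" by (meson split_list)
    then show ?thesis using p
      by (intro exI[of _ "as @ [z]"]) (auto simp: successively_append_iff hd_append split: if_splits)
  next
    case False
    then show ?thesis using p step.hyps(2)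
      by (intro exI[of _ "p @ [z]"]) (auto simp: successively_append_iff)
  qed
qed

lemma adjacency_mono: "E \<subseteq> F \<Longrightarrow> adjacency E \<subseteq> adjacency F"
  by (auto simp: adjacency_def)

lemma adjacency_rtrancl_sym: "(a, b) \<in> (adjacency E)\<^sup>* \<longleftrightarrow> (b, a) \<in> (adjacency E)\<^sup>*"
proof -
  have "(adjacency E)\<inverse> = adjacency E" by (auto simp: adjacency_def)
  then show ?thesis by (metis rtrancl_converseD rtrancl_converseI)
qed

text \<open>Deleting edges creates no cycle, and a walk from \<open>r\<close> never leaves the
  component of \<open>r\<close>, so the edges inside \<open>U\<close> suffice to connect it.\<close>

lemma finite_tree_component:
  fixes E :: "('v \<times> 'v) set"
  assumes "finite_tree V E" "E' \<subseteq> E" "r \<in> V"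
  defines "U \<equiv> {x \<in> V. (r, x) \<in> (adjacency E')\<^sup>*}"
  shows "finite_tree U (E' \<inter> U \<times> U)"
proof -
  let ?F = "E' \<inter> U \<times> U"
  have sub: "E' \<subseteq> V \<times> V" using assms(1,2) by (auto simp: finite_tree_def)
  have reach: "(r, x) \<in> (adjacency ?F)\<^sup>*" if "(r, x) \<in> (adjacency E')\<^sup>*" for x
    using that
  proof (induction rule: rtrancl_induct)
    case (step y z)
    have "y \<in> U" "z \<in> U"
      using step.hyps sub rtrancl_into_rtrancl[OF step.hyps] by (auto simp: U_def adjacency_def)
    then have "(y, z) \<in> adjacency ?F" using step.hyps(2) by (auto simp: adjacency_def)
    then show ?case using step.IH by (rule rtrancl_into_rtrancl[rotated])
  qed simp
  have "(x, y) \<in> (adjacency ?F)\<^sup>*" if "x \<in> U" "y \<in> U" for x y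
  proof -
    have "(r, x) \<in> (adjacency ?F)\<^sup>*" "(r, y) \<in> (adjacency ?F)\<^sup>*"
      using that by (auto simp: U_def intro!: reach[unfolded U_def])
    then show ?thesis using adjacency_rtrancl_sym[of r x ?F] rtrancl_trans[of x r _ y] by blast
  qed
  moreover have "\<not> is_cycle ?F p" for p
  proof
    assume "is_cycle ?F p"
    then have "is_cycle E p"
      using adjacency_mono[of ?F E] assms(2) unfolding is_cycle_def by blast
    then show False using assms(1) by (auto simp: finite_tree_def)
  qed
  moreover have "asym ?F" using assms(1,2) unfolding finite_tree_def asym_on_def by blast
  moreover have "finite U" "r \<in> U" using assms(1,3) by (auto simp: finite_tree_def U_def)
  ultimately show ?thesis by (auto simp: finite_tree_def)
qed

text \<open>A simple path from \<open>v\<close> to \<open>w\<close> avoiding \<open>e\<close> would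
  be closed to a cycle by \<open>e\<close>.\<close>

lemma finite_tree_bridge:
  assumes T: "finite_tree V E" and e: "e \<in> E" "e = (v, w) \<or> e = (w, v)"
  shows "(v, w) \<notin> (adjacency (E - {e}))\<^sup>*"
proof
  assume "(v, w) \<in> (adjacency (E - {e}))\<^sup>*"
  from rtrancl_distinct_path[OF this] obtain p where p: "p \<noteq> []" "hd p = v" "last p = w" "distinct p"
      "successively (\<lambda>a b. (a, b) \<in> adjacency (E - {e})) p"
    by blast
  have asym: "(a, b) \<in> E \<Longrightarrow> (b, a) \<notin> E" for a b
    using T by (auto simp: finite_tree_def dest: asymD)
  have vw: "v \<noteq> w" "(v, w) \<notin> adjacency (E - {e})" using asym e by (auto simp: adjacency_def)
  \<comment> \<open>One vertex is impossible as \<open>v\<close> and \<open>w\<close> differ, two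
    since the only edge between them is the deleted one; so the closed path has the length that
    \<open>is_cycle\<close> demands.\<close>
  have "length p \<noteq> 1" using p vw by (auto simp: length_Suc_conv)
  moreover have "length p \<noteq> 2" using p vw by (auto simp: numeral_2_eq_2 length_Suc_conv)
  ultimately have len: "length p \<ge> 3" using p(1) by (cases "length p") auto
  have "(p ! i, p ! (Suc i mod length p)) \<in> adjacency E" if i: "i < length p" for i
  proof (cases "Suc i < length p")
    case True
    then have "(p ! i, p ! Suc i) \<in> adjacency (E - {e})"
      using p(5) by (simp add: successively_conv_nth)
    then show ?thesis using True adjacency_mono[of "E - {e}" E] by auto
  next
    case False
    then have "i = length p - 1" "Suc i mod length p = 0" using i by (auto simp: mod_if)
    then have "p ! i = w" "p ! (Suc i mod length p) = v"
      using p(1-3) by (auto simp: last_conv_nth hd_conv_nth)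
    then show ?thesis using e by (auto simp: adjacency_def)
  qed
  then have "is_cycle E p" using len p(4) by (simp add: is_cycle_def)
  then show False using T by (auto simp: finite_tree_def)
qed

text \<open>Deleting an edge at \<open>v\<close> leaves two smaller trees, the components of its
  ends; the edge grafts one of them onto the other.\<close>

lemma finite_tree_rooted:
  assumes "finite_tree V E" "v \<in> V"
  shows "\<exists>t. rooted V E v t"
  using assms
proof (induction "card V" arbitrary: V E v rule: less_induct)
  case less
  have fin: "finite V" and sub: "E \<subseteq> V \<times> V" and conn: "\<And>x y. x \<in> V \<Longrightarrow> y \<in> V \<Longrightarrow> (x, y) \<in> (adjacency E)\<^sup>*"
    and asym: "\<And>a b. (a, b) \<in> E \<Longrightarrow> (b, a) \<notin> E"
    using less.prems(1) by (auto simp: finite_tree_def dest: asymD)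
  show ?case
  proof (cases "V = {v}")
    case True
    then have "E = {}" using sub asym by fastforce
    then show ?thesis using True rooted_Leaf[of v] by auto
  next
    case False
    then obtain u where "u \<in> V" "u \<noteq> v" using less.prems(2) by blast
    then obtain w where "(v, w) \<in> adjacency E"
      using conn[OF less.prems(2)] by (metis converse_rtranclE)
    then obtain e where e: "e \<in> E" "e = (v, w) \<or> e = (w, v)" by (auto simp: adjacency_def)
    have w: "w \<in> V" using e sub by auto
    let ?R = "adjacency (E - {e})"
    define V1 where "V1 = {x \<in> V. (v, x) \<in> ?R\<^sup>*}"
    define V2 where "V2 = {x \<in> V. (w, x) \<in> ?R\<^sup>*}"
    have br: "(v, w) \<notin> ?R\<^sup>*" by (rule finite_tree_bridge[OF less.prems(1) e])
    have T1: "finite_tree V1 ((E - {e}) \<inter> V1 \<times> V1)" and T2: "finite_tree V2 ((E - {e}) \<inter> V2 \<times> V2)"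
      unfolding V1_def V2_def using less.prems w by (auto intro!: finite_tree_component)
    have "V1 \<subset> V" "V2 \<subset> V"
      using br w less.prems(2) adjacency_rtrancl_sym[of v w] unfolding V1_def V2_def by blast+
    then have card: "card V1 < card V" "card V2 < card V"
      using fin by (simp_all add: psubset_card_mono)
    have v1: "v \<in> V1" "w \<in> V2" using less.prems(2) w by (auto simp: V1_def V2_def)
    obtain s t where st: "rooted V1 ((E - {e}) \<inter> V1 \<times> V1) v s" "rooted V2 ((E - {e}) \<inter> V2 \<times> V2) w t"
      using less.hyps[OF card(1) T1 v1(1)] less.hyps[OF card(2) T2 v1(2)] by blast
    have disj: "V1 \<inter> V2 = {}"
    proof (rule ccontr)
      assume "V1 \<inter> V2 \<noteq> {}"
      then obtain x where "(v, x) \<in> ?R\<^sup>*" "(w, x) \<in> ?R\<^sup>*" by (auto simp: V1_def V2_def)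
      then show False using br rtrancl_trans[of v x ?R w] adjacency_rtrancl_sym[of w x] by simp
    qed
    \<comment> \<open>A walk can change components only through \<open>e\<close>, and after crossing
      \<open>e\<close> it stands at \<open>v\<close> or \<open>w\<close>.\<close>
    have "(v, x) \<in> ?R\<^sup>* \<or> (w, x) \<in> ?R\<^sup>*" if "(v, x) \<in> (adjacency E)\<^sup>*" for x
      using that
    proof (induction rule: rtrancl_induct)
      case (step y z)
      show ?case
      proof (cases "(y, z) \<in> ?R")
        case True
        then show ?thesis using step.IH by (meson rtrancl_into_rtrancl)
      next
        case False
        then have "(y, z) = (v, w) \<or> (y, z) = (w, v)" using step.hyps(2) e(2) by (auto simp: adjacency_def)
        then show ?thesis by auto
      qed
    qed simp
    then have un: "V1 \<union> V2 = V"
      using conn[OF less.prems(2)] by (auto simp: V1_def V2_def)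
    have "insert e ((E - {e}) \<inter> V1 \<times> V1 \<union> (E - {e}) \<inter> V2 \<times> V2) = E"
    proof -
      have "a \<in> V1 \<longleftrightarrow> b \<in> V1" "a \<in> V2 \<longleftrightarrow> b \<in> V2" if "(a, b) \<in> E - {e}" for a b
      proof -
        have "(a, b) \<in> ?R" "(b, a) \<in> ?R" "a \<in> V" "b \<in> V" using that sub by (auto simp: adjacency_def)
        then show "a \<in> V1 \<longleftrightarrow> b \<in> V1" "a \<in> V2 \<longleftrightarrow> b \<in> V2"
          unfolding V1_def V2_def by (auto intro: rtrancl_into_rtrancl)
      qed
      then show ?thesis using e(1) sub un by blast
    qed
    then show ?thesis using rooted_Graft[OF st disj e(2)] un by auto
  qed
qed


section \<open>Solutions on trees and the limit of the S-function\<close>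

lemma end_value_scale: "end_value l (\<lambda>x. c * f x) e u = c * end_value l f e u"
  by (simp add: end_value_def)

text \<open>Differentiability at the ends is carried along because \<open>vector_derivative\<close>
  is compatible with scaling only where a derivative is known to exist.\<close>

definition edge_solution :: "real \<Rightarrow> (real \<Rightarrow> real) \<Rightarrow> complex \<Rightarrow> (real \<Rightarrow> complex) \<Rightarrow> bool" where
  "edge_solution l q \<mu> y \<longleftrightarrow> schroedinger {0..l} q \<mu> y \<and>
     y differentiable (at 0 within {0..l}) \<and> y differentiable (at l within {0..l})"

lemma edge_solution_scale: "edge_solution l q \<mu> y \<Longrightarrow> edge_solution l q \<mu> (\<lambda>x. c * y x)"
  by (auto simp: edge_solution_def intro: schroedinger_scale)

lemma outward_deriv_scale:
  assumes "l > 0" "edge_solution l q \<mu> y"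
  shows "outward_deriv l (\<lambda>x. c * y x) e u = c * outward_deriv l y e u"
proof -
  have "vector_derivative (\<lambda>x. c * y x) (at t within {0..l}) = c * vector_derivative y (at t within {0..l})"
    if "t = 0 \<or> t = l" for t
  proof (rule vector_derivative_within_closed_interval)
    have "y differentiable (at t within {0..l})" using assms(2) that by (auto simp: edge_solution_def)
    then show "((\<lambda>x. c * y x) has_vector_derivative c * vector_derivative y (at t within {0..l})) (at t within {0..l})"
      by (intro has_vector_derivative_mult_right) (simp add: vector_derivative_works)
  qed (use assms(1) that in auto)
  then show ?thesis by (simp add: outward_deriv_def)
qed

text \<open>With value \<open>1\<close> at the root, \<open>m\<close> is the Dirichlet-to-Neumann
  number of the tree there, in units of \<open>\<kappa>\<close>.\<close>

definition tree_solution ::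
    "real \<Rightarrow> ('v \<times> 'v \<Rightarrow> real \<Rightarrow> real) \<Rightarrow> complex \<Rightarrow> 'v set \<Rightarrow> ('v \<times> 'v) set \<Rightarrow> 'v \<Rightarrow>
      ('v \<times> 'v \<Rightarrow> real \<Rightarrow> complex) \<Rightarrow> complex \<Rightarrow> bool" where
  "tree_solution l q \<kappa> V E v y m \<longleftrightarrow>
     (\<forall>e\<in>E. edge_solution l (q e) (\<kappa>\<^sup>2) (y e)) \<and>
     (\<forall>u\<in>V - {v}. (\<exists>c. \<forall>e\<in>incident E u. end_value l (y e) e u = c) \<and>
        (\<Sum>e\<in>incident E u. outward_deriv l (y e) e u) = 0) \<and>
     (\<forall>e\<in>incident E v. end_value l (y e) e v = 1) \<and>
     (\<Sum>e\<in>incident E v. outward_deriv l (y e) e v) = \<kappa> * m"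

lemma incident_subset: "incident E u \<subseteq> E"
  by (auto simp: incident_def)

text \<open>At \<open>w\<close> the edge cancels the derivative sum \<open>\<kappa> * m'\<close> of
  the branch. Scaling edge and branch together by \<open>1 / A\<close> preserves the conditions at
  \<open>w\<close> and beyond and brings the value at \<open>v\<close> to \<open>1\<close>; the edge
  then adds \<open>B / A\<close> to \<open>m\<close>.\<close>

lemma tree_solution_graft:
  assumes l: "l > 0"
    and y: "tree_solution l q \<kappa> V E v y m" and z: "tree_solution l q \<kappa> W F w z m'"
    and fin: "finite E" "finite F" and E: "E \<subseteq> V \<times> V" "v \<in> V" and F: "F \<subseteq> W \<times> W" "w \<in> W"
    and disj: "V \<inter> W = {}" and e: "e = (v, w) \<or> e = (w, v)"
    and f: "edge_solution l (q e) (\<kappa>\<^sup>2) f" "end_value l f e w = 1" "outward_deriv l f e w = - (\<kappa> * m')"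
      "end_value l f e v = A" "outward_deriv l f e v = \<kappa> * B" and A: "A \<noteq> 0"
  shows "tree_solution l q \<kappa> (V \<union> W) (insert e (E \<union> F)) v
    (\<lambda>d. if d \<in> E then y d else (\<lambda>x. inverse A * (if d = e then f else z d) x)) (m + B / A)"
    (is "tree_solution l q \<kappa> _ ?G v ?y _")
proof -
  have nE: "e \<notin> E" and nF: "e \<notin> F" using E F disj e by auto
  have EF: "E \<inter> F = {}" using E F disj by auto
  have yE: "?y d = y d" if "d \<in> E" for d using that by simp
  have ye: "?y e = (\<lambda>x. inverse A * f x)" using nE by simp
  have yF: "?y d = (\<lambda>x. inverse A * z d x)" if "d \<in> F" for d using that EF nF by auto
  have zF: "edge_solution l (q d) (\<kappa>\<^sup>2) (z d)" if "d \<in> F" for d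
    using z that by (simp add: tree_solution_def)
  have odF: "outward_deriv l (?y d) d u = inverse A * outward_deriv l (z d) d u" if "d \<in> F" for d u
    unfolding yF[OF that] by (rule outward_deriv_scale[OF l zF[OF that]])
  have ode: "outward_deriv l (?y e) e u = inverse A * outward_deriv l f e u" for u
    unfolding ye by (rule outward_deriv_scale[OF l f(1)])
  have sumE: "(\<Sum>d\<in>incident E u. outward_deriv l (?y d) d u) = (\<Sum>d\<in>incident E u. outward_deriv l (y d) d u)" for u
    by (rule sum.cong) (auto simp: incident_def)
  have sumF: "(\<Sum>d\<in>incident F u. outward_deriv l (?y d) d u) =
      inverse A * (\<Sum>d\<in>incident F u. outward_deriv l (z d) d u)" for u
    unfolding sum_distrib_left
  proof (rule sum.cong[OF refl])
    fix d assume "d \<in> incident F u"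
    then have "d \<in> F" by (simp add: incident_def)
    then show "outward_deriv l (?y d) d u = inverse A * outward_deriv l (z d) d u" by (rule odF)
  qed
  have inc: "incident ?G u = incident E u" if "u \<in> V" "u \<noteq> v" for u
    using that E F disj e by (auto simp: incident_def)
  have inc': "incident ?G u = incident F u" if "u \<in> W" "u \<noteq> w" for u
    using that E F disj e by (auto simp: incident_def)
  have incv: "incident ?G v = insert e (incident E v)"
    using E F disj e by (auto simp: incident_def)
  have incw: "incident ?G w = insert e (incident F w)"
    using E F disj e by (auto simp: incident_def)
  have fin': "finite (incident E v)" "finite (incident F w)"
    by (rule finite_subset[OF incident_subset fin(1)], rule finite_subset[OF incident_subset fin(2)])
  have nin: "e \<notin> incident E v" "e \<notin> incident F w" using nE nF by (auto simp: incident_def)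
  show ?thesis
    unfolding tree_solution_def
  proof (intro conjI ballI)
    fix d assume "d \<in> ?G"
    then consider "d \<in> E" | "d = e" | "d \<in> F" by blast
    then show "edge_solution l (q d) (\<kappa>\<^sup>2) (?y d)"
    proof cases
      case 1
      then show ?thesis using y by (simp add: tree_solution_def)
    next
      case 2
      show ?thesis unfolding 2 ye by (rule edge_solution_scale[OF f(1)])
    next
      case 3
      show ?thesis unfolding yF[OF 3] by (rule edge_solution_scale[OF zF[OF 3]])
    qed
  next
    fix u assume u: "u \<in> V \<union> W - {v}"
    then consider "u \<in> V" "u \<noteq> v" | "u = w" | "u \<in> W" "u \<noteq> w" by blast
    then have "(\<exists>c. \<forall>d\<in>incident ?G u. end_value l (?y d) d u = c) \<and>
        (\<Sum>d\<in>incident ?G u. outward_deriv l (?y d) d u) = 0"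
    proof cases
      case 1
      then have *: "(\<exists>c. \<forall>d\<in>incident E u. end_value l (y d) d u = c)"
          "(\<Sum>d\<in>incident E u. outward_deriv l (y d) d u) = 0"
        using y by (simp_all add: tree_solution_def)
      have "\<forall>d\<in>incident E u. end_value l (?y d) d u = end_value l (y d) d u"
        by (auto simp: incident_def)
      then show ?thesis unfolding inc[OF 1] sumE using * by auto
    next
      case 2
      have "end_value l (?y d) d w = inverse A" if "d \<in> insert e (incident F w)" for d
      proof (cases "d = e")
        case True
        show ?thesis unfolding True ye end_value_scale f(2) by simp
      next
        case False
        then have d: "d \<in> incident F w" "d \<in> F" using that by (auto simp: incident_def)
        have "end_value l (z d) d w = 1" using z d(1) by (simp add: tree_solution_def)
        then show ?thesis unfolding yF[OF d(2)] end_value_scale by simp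
      qed
      moreover have "(\<Sum>d\<in>insert e (incident F w). outward_deriv l (?y d) d w) = 0"
      proof -
        have "(\<Sum>d\<in>incident F w. outward_deriv l (z d) d w) = \<kappa> * m'"
          using z by (simp add: tree_solution_def)
        then show ?thesis
          unfolding sum.insert[OF fin'(2) nin(2)] sumF ode f(3) by (simp add: algebra_simps)
      qed
      ultimately show ?thesis unfolding 2 incw by blast
    next
      case 3
      then obtain c where c: "\<forall>d\<in>incident F u. end_value l (z d) d u = c"
        and 0: "(\<Sum>d\<in>incident F u. outward_deriv l (z d) d u) = 0"
        using z unfolding tree_solution_def by blast
      have "end_value l (?y d) d u = inverse A * c" if d: "d \<in> incident F u" for d
      proof -
        have "d \<in> F" using d by (simp add: incident_def)
        then show ?thesis unfolding yF[OF \<open>d \<in> F\<close>] end_value_scale using c d by simp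
      qed
      then show ?thesis unfolding inc'[OF 3] sumF 0 by auto
    qed
    then show "\<exists>c. \<forall>d\<in>incident ?G u. end_value l (?y d) d u = c"
      "(\<Sum>d\<in>incident ?G u. outward_deriv l (?y d) d u) = 0" by blast+
  next
    fix d assume "d \<in> incident ?G v"
    then consider "d = e" | "d \<in> incident E v" "d \<in> E" unfolding incv by (auto simp: incident_def)
    then show "end_value l (?y d) d v = 1"
    proof cases
      case 1
      show ?thesis unfolding 1 ye end_value_scale f(4) using A by simp
    next
      case 2
      then show ?thesis using y by (simp add: tree_solution_def)
    qed
  next
    have "(\<Sum>d\<in>incident E v. outward_deriv l (y d) d v) = \<kappa> * m"
      using y by (simp add: tree_solution_def)
    then show "(\<Sum>d\<in>incident ?G v. outward_deriv l (?y d) d v) = \<kappa> * (m + B / A)"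
      unfolding incv sum.insert[OF fin'(1) nin(1)] sumE ode f(5) by (simp add: field_simps)
  qed
qed

text \<open>The limits are those of cosh and -i times sin at hyperbolic tangent
  \<open>2 / 3\<close>: the common factor \<open>\<gamma>\<close> cancels in the quotient
  \<open>B / A\<close>, and only the numbers \<open>3\<close> and \<open>2\<close> of
  \<open>weight\<close> remain.\<close>

locale tanh_quasi_momenta = quasi_momenta l k "of_real (3 * \<gamma>)" "\<i> * of_real (2 * \<gamma>)"
  for l :: real and k :: "nat \<Rightarrow> complex" and \<gamma> :: real +
  assumes \<gamma>_pos: "\<gamma> > 0"
begin

lemma solution_data_end:
  assumes "solution_data q n y a b a' b'" "v \<noteq> w"
  shows "edge_solution l q ((k n)\<^sup>2) y"
    "end_value l y (v, w) v = a" "outward_deriv l y (v, w) v = k n * b"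
    "end_value l y (v, w) w = a'" "outward_deriv l y (v, w) w = - (k n * b')"
proof -
  have "vector_derivative y (at 0 within {0..l}) = k n * b" "vector_derivative y (at l within {0..l}) = k n * b'"
    using assms(1) l_pos by (auto simp: solution_data_def intro!: vector_derivative_within_closed_interval)
  then show "edge_solution l q ((k n)\<^sup>2) y"
    "end_value l y (v, w) v = a" "outward_deriv l y (v, w) v = k n * b"
    "end_value l y (v, w) w = a'" "outward_deriv l y (v, w) w = - (k n * b')"
    using assms by (auto simp: solution_data_def edge_solution_def end_value_def outward_deriv_def
        intro: differentiableI_vector)
qed

text \<open>The Kirchhoff condition fixes the data at \<open>w\<close>, and carrying them to
  \<open>v\<close> gives a quotient \<open>B / A\<close> that tends to \<open>\<i>\<close> times the
  fraction in \<open>weight\<close>.\<close>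

lemma branch_edge:
  assumes q: "L2_on {0<..<l} q" and m: "m \<longlonglongrightarrow> \<i> * of_real \<mu>" and e: "e = (v, w) \<or> e = (w, v)" "v \<noteq> w"
  shows "\<exists>f A B. (\<forall>\<^sub>F n in sequentially. edge_solution l q ((k n)\<^sup>2) (f n) \<and>
      end_value l (f n) e w = 1 \<and> outward_deriv l (f n) e w = - (k n * m n) \<and>
      end_value l (f n) e v = A n \<and> outward_deriv l (f n) e v = k n * B n) \<and>
    A \<longlonglongrightarrow> of_real (\<gamma> * (3 + 2 * \<mu>)) \<and> B \<longlonglongrightarrow> \<i> * of_real (\<gamma> * (2 + 3 * \<mu>))"
  using e(1)
proof
  assume e: "e = (v, w)"
  obtain f A B where f: "\<forall>\<^sub>F n in sequentially. solution_data q n (f n) (A n) (B n) 1 (m n)"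
    and A: "A \<longlonglongrightarrow> of_real (3 * \<gamma>) - \<i> * of_real (2 * \<gamma>) * (\<i> * of_real \<mu>)"
    and B: "B \<longlonglongrightarrow> \<i> * of_real (2 * \<gamma>) + of_real (3 * \<gamma>) * (\<i> * of_real \<mu>)"
    using solution_with_right_data[OF q m] by blast
  have f': "\<forall>\<^sub>F n in sequentially. edge_solution l q ((k n)\<^sup>2) (f n) \<and>
      end_value l (f n) e w = 1 \<and> outward_deriv l (f n) e w = - (k n * m n) \<and>
      end_value l (f n) e v = A n \<and> outward_deriv l (f n) e v = k n * B n"
    using f
  proof eventually_elim
    case (elim n)
    show ?case unfolding e using solution_data_end[OF elim \<open>v \<noteq> w\<close>] by simp
  qed
  have eq: "of_real (3 * \<gamma>) - \<i> * of_real (2 * \<gamma>) * (\<i> * of_real \<mu>) = complex_of_real (\<gamma> * (3 + 2 * \<mu>))"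
    "\<i> * of_real (2 * \<gamma>) + of_real (3 * \<gamma>) * (\<i> * of_real \<mu>) = \<i> * complex_of_real (\<gamma> * (2 + 3 * \<mu>))"
    by (simp_all add: complex_eq_iff algebra_simps)
  show ?thesis
    by (rule exI[of _ f], rule exI[of _ A], rule exI[of _ B])
      (intro conjI f' A[unfolded eq(1)] B[unfolded eq(2)])
next
  \<comment> \<open>Now the edge starts at \<open>w\<close>, where outward means increasing, so the
    slope is \<open>- m n\<close>. At \<open>v\<close> outward means decreasing, which turns
    \<open>B\<close> into \<open>- B\<close>.\<close>
  assume e: "e = (w, v)"
  have "(\<lambda>n. - m n) \<longlonglongrightarrow> - (\<i> * of_real \<mu>)" by (intro tendsto_intros m)
  then obtain f A B where f: "\<forall>\<^sub>F n in sequentially. solution_data q n (f n) 1 (- m n) (A n) (B n)"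
    and A: "A \<longlonglongrightarrow> of_real (3 * \<gamma>) + \<i> * of_real (2 * \<gamma>) * (- (\<i> * of_real \<mu>))"
    and B: "B \<longlonglongrightarrow> of_real (3 * \<gamma>) * (- (\<i> * of_real \<mu>)) - \<i> * of_real (2 * \<gamma>)"
    using solution_with_left_data[OF q] by blast
  have f': "\<forall>\<^sub>F n in sequentially. edge_solution l q ((k n)\<^sup>2) (f n) \<and>
      end_value l (f n) e w = 1 \<and> outward_deriv l (f n) e w = - (k n * m n) \<and>
      end_value l (f n) e v = A n \<and> outward_deriv l (f n) e v = k n * (- B n)"
    using f
  proof eventually_elim
    case (elim n)
    show ?case unfolding e using solution_data_end[OF elim \<open>v \<noteq> w\<close>[symmetric]] by simp
  qed
  have eq: "of_real (3 * \<gamma>) + \<i> * of_real (2 * \<gamma>) * (- (\<i> * of_real \<mu>)) = complex_of_real (\<gamma> * (3 + 2 * \<mu>))"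
    "- (of_real (3 * \<gamma>) * (- (\<i> * of_real \<mu>)) - \<i> * of_real (2 * \<gamma>)) = \<i> * complex_of_real (\<gamma> * (2 + 3 * \<mu>))"
    by (simp_all add: complex_eq_iff algebra_simps)
  have B': "(\<lambda>n. - B n) \<longlonglongrightarrow> - (of_real (3 * \<gamma>) * (- (\<i> * of_real \<mu>)) - \<i> * of_real (2 * \<gamma>))"
    by (intro tendsto_minus B)
  show ?thesis
    by (rule exI[of _ f], rule exI[of _ A], rule exI[of _ "\<lambda>n. - B n"])
      (intro conjI f' A[unfolded eq(1)] B'[unfolded eq(2)])
qed

text \<open>The recursion of \<open>weight\<close> is the limit of the grafting step;
  \<open>q\<close> contributes only errors that vanish with \<open>n\<close>.\<close>

lemma tree_solution_exists:
  assumes "rooted V E v t" "\<forall>e\<in>E. L2_on {0<..<l} (q e)"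
  shows "\<exists>y m. (\<forall>\<^sub>F n in sequentially. tree_solution l q (k n) V E v (y n) (m n)) \<and>
    m \<longlonglongrightarrow> \<i> * of_real (weight t)"
  using assms
proof (induction rule: rooted.induct)
  case (rooted_Leaf v)
  then show ?case
    by (intro exI[of _ "\<lambda>_ _ _. 0"] exI[of _ "\<lambda>_. 0"]) (simp add: tree_solution_def incident_def)
next
  case (rooted_Graft V E v s W F w t e)
  obtain y m where y: "\<forall>\<^sub>F n in sequentially. tree_solution l q (k n) V E v (y n) (m n)"
    and m: "m \<longlonglongrightarrow> \<i> * of_real (weight s)" using rooted_Graft by blast
  obtain z m' where z: "\<forall>\<^sub>F n in sequentially. tree_solution l q (k n) W F w (z n) (m' n)"
    and m': "m' \<longlonglongrightarrow> \<i> * of_real (weight t)" using rooted_Graft by blast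
  note r = rooted_facts[OF rooted_Graft.hyps(1)] and r' = rooted_facts[OF rooted_Graft.hyps(2)]
  have "v \<noteq> w" using r(3) r'(3) rooted_Graft.hyps(3) by blast
  have "L2_on {0<..<l} (q e)" using rooted_Graft.prems by blast
  from branch_edge[OF this m' rooted_Graft.hyps(4) \<open>v \<noteq> w\<close>]
  obtain f A B where f: "\<forall>\<^sub>F n in sequentially. edge_solution l (q e) ((k n)\<^sup>2) (f n) \<and>
      end_value l (f n) e w = 1 \<and> outward_deriv l (f n) e w = - (k n * m' n) \<and>
      end_value l (f n) e v = A n \<and> outward_deriv l (f n) e v = k n * B n"
    and A: "A \<longlonglongrightarrow> of_real (\<gamma> * (3 + 2 * weight t))" and B: "B \<longlonglongrightarrow> \<i> * of_real (\<gamma> * (2 + 3 * weight t))"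
    by blast
  \<comment> \<open>Nonnegativity of the weights keeps the value at \<open>v\<close> away from zero
    in the limit, so dividing by \<open>A n\<close> is legitimate for large
    \<open>n\<close>.\<close>
  have pos: "3 + 2 * weight t > 0" using weight_nonneg[of t] by linarith
  then have lim0: "complex_of_real (\<gamma> * (3 + 2 * weight t)) \<noteq> 0" using \<gamma>_pos by (simp only: of_real_eq_0_iff) simp
  have A0: "\<forall>\<^sub>F n in sequentially. A n \<noteq> 0" by (rule tendsto_imp_eventually_ne[OF A lim0])
  show ?case
  proof (intro exI conjI)
    show "\<forall>\<^sub>F n in sequentially. tree_solution l q (k n) (V \<union> W) (insert e (E \<union> F)) v
        (\<lambda>d. if d \<in> E then y n d else (\<lambda>x. inverse (A n) * (if d = e then f n else z n d) x)) (m n + B n / A n)"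
      using y z f A0
    proof eventually_elim
      case (elim n)
      show ?case
        by (rule tree_solution_graft[OF l_pos elim(1,2) r(2) r'(2) r(4,3) r'(4,3) rooted_Graft.hyps(3,4)])
          (use elim in auto)
    qed
    have "(\<lambda>n. m n + B n / A n) \<longlonglongrightarrow> \<i> * of_real (weight s) +
        \<i> * of_real (\<gamma> * (2 + 3 * weight t)) / of_real (\<gamma> * (3 + 2 * weight t))"
      by (intro tendsto_intros m A B lim0)
    also have "\<i> * of_real (\<gamma> * (2 + 3 * weight t)) / of_real (\<gamma> * (3 + 2 * weight t)) =
        \<i> * complex_of_real ((2 + 3 * weight t) / (3 + 2 * weight t))"
      using \<gamma>_pos by simp
    finally show "(\<lambda>n. m n + B n / A n) \<longlonglongrightarrow> \<i> * of_real (weight (Graft t s))"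
      by (simp add: distrib_left)
  qed
qed

text \<open>The joint normalisation of the characteristic functions makes their quotient the
  Dirichlet-to-Neumann number, so S depends on \<open>m n\<close> alone.\<close>

lemma S_function_limit:
  assumes T: "equilateral_lead_tree l T" "rooted (vertices T) (edges T) (lead_vertex T) t"
    and \<phi>: "characteristic_functions l T \<phi>\<^sub>N \<phi>\<^sub>D" "\<And>n. \<phi>\<^sub>D ((k n)\<^sup>2) \<noteq> 0"
  shows "(\<lambda>n. S_function \<phi>\<^sub>N \<phi>\<^sub>D (k n)) \<longlonglongrightarrow> of_real ((weight t - 1) / (weight t + 1))"
proof -
  have "\<forall>e\<in>edges T. L2_on {0<..<l} (potential T e)"
    using T(1) by (simp add: equilateral_lead_tree_def)
  from tree_solution_exists[OF T(2) this] obtain y m where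
    y: "\<forall>\<^sub>F n in sequentially. tree_solution l (potential T) (k n) (vertices T) (edges T) (lead_vertex T) (y n) (m n)"
    and m: "m \<longlonglongrightarrow> \<i> * of_real (weight t)" by blast
  have "\<forall>\<^sub>F n in sequentially. S_function \<phi>\<^sub>N \<phi>\<^sub>D (k n) = (m n - \<i>) / (m n + \<i>)"
    using y k_nonzero
  proof eventually_elim
    case (elim n)
    define D where "D = \<phi>\<^sub>D ((k n)\<^sup>2)"
    have D: "D \<noteq> 0" using \<phi>(2) by (simp add: D_def)
    \<comment> \<open>Rescaled to the value \<open>\<phi>\<^sub>D\<close> at the lead vertex, as the
      normalisation clause requires.\<close>
    define z where "z e x = D * y n e x" for e x
    have es: "edge_solution l (potential T e) ((k n)\<^sup>2) (y n e)" if "e \<in> edges T" for e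
      using elim(1) that by (simp add: tree_solution_def)
    have z_abs: "z e = (\<lambda>x. D * y n e x)" for e by (simp add: z_def[abs_def])
    have ev: "end_value l (z e) e u = D * end_value l (y n e) e u" for e u
      unfolding z_abs by (rule end_value_scale)
    have ds: "deriv_sum l T z u = D * (\<Sum>e\<in>incident (edges T) u. outward_deriv l (y n e) e u)" for u
      unfolding deriv_sum_def sum_distrib_left
    proof (rule sum.cong[OF refl])
      fix e assume "e \<in> incident (edges T) u"
      then have "e \<in> edges T" by (simp add: incident_def)
      then show "outward_deriv l (z e) e u = D * outward_deriv l (y n e) e u"
        unfolding z_abs by (intro outward_deriv_scale[OF l_pos es])
    qed
    have "solves_inside l T ((k n)\<^sup>2) z"
      unfolding solves_inside_def
    proof (intro conjI ballI)
      fix e assume "e \<in> edges T"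
      then show "schroedinger {0..l} (potential T e) ((k n)\<^sup>2) (z e)"
        using es unfolding z_abs edge_solution_def by (intro schroedinger_scale) simp
    next
      fix u assume "u \<in> vertices T - {lead_vertex T}"
      then obtain c where "\<forall>e\<in>incident (edges T) u. end_value l (y n e) e u = c"
        "(\<Sum>e\<in>incident (edges T) u. outward_deriv l (y n e) e u) = 0"
        using elim(1) unfolding tree_solution_def by blast
      then have "\<forall>e\<in>incident (edges T) u. end_value l (z e) e u = D * c" "deriv_sum l T z u = 0"
        by (simp_all add: ev ds)
      then show "standard_at l T z u"
        unfolding standard_at_def has_vertex_value_def by blast
    qed
    moreover have "has_vertex_value l T z (lead_vertex T) (\<phi>\<^sub>D ((k n)\<^sup>2))"
      using elim(1) unfolding has_vertex_value_def ev by (simp add: tree_solution_def D_def)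
    ultimately have "- deriv_sum l T z (lead_vertex T) = \<phi>\<^sub>N ((k n)\<^sup>2)"
      using \<phi> unfolding characteristic_functions_def by blast
    then have N: "\<phi>\<^sub>N ((k n)\<^sup>2) = - (D * (k n * m n))"
      using elim(1) unfolding ds by (simp add: tree_solution_def)
    have "jost_function \<phi>\<^sub>N \<phi>\<^sub>D (k n) = - (D * k n) * (m n - \<i>)"
      "jost_function \<phi>\<^sub>N \<phi>\<^sub>D (- k n) = - (D * k n) * (m n + \<i>)"
      unfolding jost_function_def power2_minus N D_def[symmetric] by (simp_all add: algebra_simps)
    then show ?case using D elim(2) by (simp add: S_function_def)
  qed
  moreover have "(\<lambda>n. (m n - \<i>) / (m n + \<i>)) \<longlonglongrightarrow> of_real ((weight t - 1) / (weight t + 1))"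
  proof -
    have w: "weight t + 1 \<noteq> 0" using weight_nonneg[of t] by linarith
    have e: "\<i> * of_real (weight t) - \<i> = \<i> * of_real (weight t - 1)"
      "\<i> * of_real (weight t) + \<i> = \<i> * of_real (weight t + 1)" by (simp_all add: algebra_simps)
    have ne: "\<i> * of_real (weight t) + \<i> \<noteq> 0" unfolding e using w by (simp only: mult_eq_0_iff of_real_eq_0_iff) simp
    have "(\<lambda>n. (m n - \<i>) / (m n + \<i>)) \<longlonglongrightarrow> (\<i> * of_real (weight t) - \<i>) / (\<i> * of_real (weight t) + \<i>)"
      by (intro tendsto_intros m ne)
    then show ?thesis unfolding e by simp
  qed
  ultimately show ?thesis by (simp add: tendsto_cong)
qed

end

section \<open>Choosing the sequence of points\<close>

lemma eventually_cosparse_nonzero: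
  assumes "f holomorphic_on UNIV" "f \<beta> \<noteq> (0 :: complex)"
  shows "\<forall>\<^sub>\<approx>z. f z \<noteq> 0"
  unfolding eventually_cosparse_open_eq[OF open_UNIV]
proof
  fix z :: complex
  show "\<forall>\<^sub>F x in at z. f x \<noteq> 0"
  proof (cases "f z = 0")
    case True
    obtain r where r: "r > 0" "\<And>x. x \<in> ball z r - {z} \<Longrightarrow> f x \<noteq> 0"
      by (rule isolated_zeros[OF assms(1) open_UNIV connected_UNIV UNIV_I True UNIV_I assms(2)]) auto
    have "f x \<noteq> 0" if "x \<noteq> z" "dist x z < r" for x
      using r(2)[of x] that by (simp add: dist_commute)
    then show ?thesis unfolding eventually_at using r(1) by blast
  next
    case False
    have "isCont f z"
      using holomorphic_on_imp_continuous_on[OF assms(1)] by (simp add: continuous_on_eq_continuous_at)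
    then show ?thesis using False by (auto simp: isCont_def intro: tendsto_imp_eventually_ne)
  qed
qed

text \<open>A cosparse property may fail at a given point but holds at points arbitrarily close to
  it. Points within \<open>1 / (n + 1)\<close> of \<open>w n + \<i> \<kappa>\<close> inherit the
  limits of cosine and sine by periodicity.\<close>

lemma tanh_quasi_momenta_exist:
  assumes l: "l > 0" and P: "\<forall>\<^sub>\<approx>k. P k"
  obtains k \<gamma> where "tanh_quasi_momenta l k \<gamma>" "\<And>n. P (k n)"
proof -
  \<comment> \<open>Chosen since
    \<open>tanh (ln (sqrt 5)) = (5 - 1) / (5 + 1) = 2 / 3\<close>.\<close>
  define \<kappa> where "\<kappa> = ln (sqrt 5) / l"
  define w :: "nat \<Rightarrow> complex" where "w n = of_real (2 * pi * real n / l)" for n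
  have "\<exists>x. P x \<and> dist x (w n + \<i> * of_real \<kappa>) < inverse (real (Suc n))" for n
  proof -
    have "\<forall>\<^sub>F x in at (w n + \<i> * of_real \<kappa>). P x"
      using P by (simp add: eventually_cosparse_open_eq)
    moreover have "\<forall>\<^sub>F x in at (w n + \<i> * of_real \<kappa>). dist x (w n + \<i> * of_real \<kappa>) < inverse (real (Suc n))"
      by (auto simp: eventually_at intro!: exI[of _ "inverse (real (Suc n))"])
    ultimately have "\<forall>\<^sub>F x in at (w n + \<i> * of_real \<kappa>). P x \<and> dist x (w n + \<i> * of_real \<kappa>) < inverse (real (Suc n))"
      by (rule eventually_conj)
    then show ?thesis using eventually_happens by force
  qed
  then obtain k where k: "\<And>n. P (k n)" "\<And>n. dist (k n) (w n + \<i> * of_real \<kappa>) < inverse (real (Suc n))"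
    by metis
  define d where "d n = k n - w n" for n
  have dn: "norm (d n - \<i> * of_real \<kappa>) < inverse (real (Suc n))" for n
    using k(2)[of n] by (simp add: dist_norm d_def algebra_simps)
  have "(\<lambda>n. d n - \<i> * of_real \<kappa>) \<longlonglongrightarrow> 0"
    by (rule Lim_null_comparison[OF _ LIMSEQ_inverse_real_of_nat])
      (intro always_eventually allI order_less_imp_le dn)
  then have d: "d \<longlonglongrightarrow> \<i> * of_real \<kappa>" by (simp add: LIM_zero_iff)
  have kd: "k n * of_real l = d n * of_real l + of_real (2 * pi * real n)" for n
    using l by (simp add: d_def w_def algebra_simps)
  have per: "cos (complex_of_real (2 * pi * real n)) = 1" "sin (complex_of_real (2 * pi * real n)) = 0" for n
    using cos_2npi[of n] sin_2npi[of n] by (simp_all only: cos_of_real sin_of_real mult.commute mult.left_commute) simp_all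
  have cs: "cos (k n * of_real l) = cos (d n * of_real l)" "sin (k n * of_real l) = sin (d n * of_real l)" for n
    unfolding kd by (simp_all only: cos_add sin_add per) simp_all
  have \<kappa>l: "\<i> * of_real \<kappa> * of_real l = \<i> * complex_of_real (ln (sqrt 5))"
    using l by (simp add: \<kappa>_def)
  have s5: "sqrt 5 * sqrt 5 = (5::real)" "sqrt 5 > (0::real)" by simp_all
  define \<gamma> where "\<gamma> = 1 / sqrt 5"
  have ch: "cosh (ln (sqrt 5)) = 3 * \<gamma>" and sh: "sinh (ln (sqrt 5)) = 2 * \<gamma>"
    using s5 by (simp_all add: cosh_ln_real sinh_ln_real \<gamma>_def field_simps)
  have lim: "(\<lambda>n. cos (k n * of_real l)) \<longlonglongrightarrow> of_real (3 * \<gamma>)" "(\<lambda>n. sin (k n * of_real l)) \<longlonglongrightarrow> \<i> * of_real (2 * \<gamma>)"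
  proof -
    have "(\<lambda>n. cos (d n * of_real l)) \<longlonglongrightarrow> cos (\<i> * of_real \<kappa> * of_real l)"
      "(\<lambda>n. sin (d n * of_real l)) \<longlonglongrightarrow> sin (\<i> * of_real \<kappa> * of_real l)"
      by (intro tendsto_intros d)+
    moreover have "cos (\<i> * complex_of_real x) = of_real (cosh x)" "sin (\<i> * complex_of_real x) = \<i> * of_real (sinh x)" for x
      by (simp_all add: cosh_def sinh_def cos_exp_eq sin_exp_eq exp_of_real scaleR_conv_of_real exp_minus field_simps)
    ultimately show "(\<lambda>n. cos (k n * of_real l)) \<longlonglongrightarrow> of_real (3 * \<gamma>)" "(\<lambda>n. sin (k n * of_real l)) \<longlonglongrightarrow> \<i> * of_real (2 * \<gamma>)"
      unfolding cs \<kappa>l by (simp_all only: ch sh)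
  qed
  have inf: "filterlim (\<lambda>n. norm (k n)) at_top sequentially"
  proof (rule filterlim_at_top_mono)
    show "filterlim (\<lambda>n. - 1 + 2 * pi / l * real n) at_top sequentially"
      using l by (intro filterlim_tendsto_add_at_top[OF tendsto_const]
          filterlim_tendsto_pos_mult_at_top[OF tendsto_const] filterlim_real_sequentially) simp
    have "- 1 + 2 * pi / l * real n \<le> norm (k n)" for n
    proof -
      have "\<bar>Re (d n - \<i> * of_real \<kappa>)\<bar> \<le> 1"
        using abs_Re_le_cmod[of "d n - \<i> * of_real \<kappa>"] dn[of n] by (smt (verit) inverse_le_1_iff of_nat_Suc of_nat_0_le_iff)
      then have "Re (d n) \<ge> - 1" by simp
      moreover have "Re (k n) = Re (d n) + 2 * pi * real n / l" by (simp add: d_def w_def)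
      ultimately show ?thesis using complex_Re_le_cmod[of "k n"] by simp
    qed
    then show "\<forall>\<^sub>F n in sequentially. - 1 + 2 * pi / l * real n \<le> norm (k n)" by simp
  qed
  have Im: "\<exists>K. \<forall>n. \<bar>Im (k n)\<bar> \<le> K"
  proof -
    have "Bseq d" using d by (rule convergentI[THEN convergent_imp_Bseq])
    then obtain K where K: "\<And>n. norm (d n) \<le> K" by (auto simp: Bseq_def)
    have "\<bar>Im (k n)\<bar> \<le> K" for n
      using abs_Im_le_cmod[of "d n"] K[of n] by (simp add: d_def w_def)
    then show ?thesis by blast
  qed
  have "tanh_quasi_momenta l k \<gamma>"
    by unfold_locales (use l inf Im lim s5 in \<open>auto simp: \<gamma>_def\<close>)
  then show ?thesis using k(1) that by blast
qed

theorem theorem5p1: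
  fixes l :: real and T\<^sub>1 :: "'v lead_tree" and T\<^sub>2 :: "'w lead_tree"
    and \<phi>\<^sub>N\<^sub>1 \<phi>\<^sub>D\<^sub>1 \<phi>\<^sub>N\<^sub>2 \<phi>\<^sub>D\<^sub>2 :: "complex \<Rightarrow> complex"
  assumes "l > 0"
    and "equilateral_lead_tree l T\<^sub>1" and "equilateral_lead_tree l T\<^sub>2"
    and "card (vertices T\<^sub>1) \<le> 9" and "card (vertices T\<^sub>2) \<le> 9"
    and "card (edges T\<^sub>1) \<ge> 2" and "card (edges T\<^sub>2) \<ge> 2"
    and "characteristic_functions l T\<^sub>1 \<phi>\<^sub>N\<^sub>1 \<phi>\<^sub>D\<^sub>1"
    and "characteristic_functions l T\<^sub>2 \<phi>\<^sub>N\<^sub>2 \<phi>\<^sub>D\<^sub>2"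
    and S_functions_coincide:
      "\<forall>\<^sub>\<approx>k. S_function \<phi>\<^sub>N\<^sub>1 \<phi>\<^sub>D\<^sub>1 k = S_function \<phi>\<^sub>N\<^sub>2 \<phi>\<^sub>D\<^sub>2 k"
    and eigenvalues_coincide:
      "\<forall>\<mu>. multiplicity_lead l T\<^sub>1 \<mu> = multiplicity_lead l T\<^sub>2 \<mu>"
  shows "graph_isomorphic (vertices T\<^sub>1) (edges T\<^sub>1) (vertices T\<^sub>2) (edges T\<^sub>2)"
proof -
  have nonzero: "\<forall>\<^sub>\<approx>k. \<phi>\<^sub>D (k\<^sup>2) \<noteq> 0" if \<phi>: "characteristic_functions l T \<phi>\<^sub>N \<phi>\<^sub>D"
    for T :: "'u lead_tree" and \<phi>\<^sub>N \<phi>\<^sub>D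
  proof -
    obtain z where "\<phi>\<^sub>D z \<noteq> 0" and hol: "\<phi>\<^sub>D holomorphic_on UNIV"
      using \<phi> by (auto simp: characteristic_functions_def zeros_are_eigenvalues_def entire_order_le_def)
    \<comment> \<open>A square root pulls the nonzero value back, so the entire function of
      \<open>k\<close> does not vanish identically.\<close>
    then have "\<phi>\<^sub>D ((csqrt z)\<^sup>2) \<noteq> 0" by simp
    moreover have "(\<lambda>k. \<phi>\<^sub>D (k\<^sup>2)) holomorphic_on UNIV"
      using holomorphic_on_compose_gen[OF _ hol, of "\<lambda>k. k\<^sup>2" UNIV] by (simp add: o_def holomorphic_intros)
    ultimately show ?thesis using eventually_cosparse_nonzero[of "\<lambda>k. \<phi>\<^sub>D (k\<^sup>2)" "csqrt z"] by simp
  qed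
  have "\<forall>\<^sub>\<approx>k. S_function \<phi>\<^sub>N\<^sub>1 \<phi>\<^sub>D\<^sub>1 k = S_function \<phi>\<^sub>N\<^sub>2 \<phi>\<^sub>D\<^sub>2 k \<and> \<phi>\<^sub>D\<^sub>1 (k\<^sup>2) \<noteq> 0 \<and> \<phi>\<^sub>D\<^sub>2 (k\<^sup>2) \<noteq> 0"
    using S_functions_coincide nonzero[OF assms(8)] nonzero[OF assms(9)] by (intro eventually_conj)
  then obtain k \<gamma> where k: "tanh_quasi_momenta l k \<gamma>"
      "\<And>n. S_function \<phi>\<^sub>N\<^sub>1 \<phi>\<^sub>D\<^sub>1 (k n) = S_function \<phi>\<^sub>N\<^sub>2 \<phi>\<^sub>D\<^sub>2 (k n) \<and> \<phi>\<^sub>D\<^sub>1 ((k n)\<^sup>2) \<noteq> 0 \<and> \<phi>\<^sub>D\<^sub>2 ((k n)\<^sup>2) \<noteq> 0"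
    by (rule tanh_quasi_momenta_exist[OF \<open>l > 0\<close>]) blast
  interpret tanh_quasi_momenta l k \<gamma> by (rule k(1))
  have ft: "finite_tree (vertices T\<^sub>1) (edges T\<^sub>1)" "lead_vertex T\<^sub>1 \<in> vertices T\<^sub>1"
    "finite_tree (vertices T\<^sub>2) (edges T\<^sub>2)" "lead_vertex T\<^sub>2 \<in> vertices T\<^sub>2"
    using assms(2,3) by (simp_all add: equilateral_lead_tree_def)
  obtain u\<^sub>1 where "rooted (vertices T\<^sub>1) (edges T\<^sub>1) (lead_vertex T\<^sub>1) u\<^sub>1"
    using finite_tree_rooted[OF ft(1,2)] by blast
  from rooted_descending[OF this] obtain t\<^sub>1 where t1: "descending t\<^sub>1" "rooted (vertices T\<^sub>1) (edges T\<^sub>1) (lead_vertex T\<^sub>1) t\<^sub>1"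
    by blast
  obtain u\<^sub>2 where "rooted (vertices T\<^sub>2) (edges T\<^sub>2) (lead_vertex T\<^sub>2) u\<^sub>2"
    using finite_tree_rooted[OF ft(3,4)] by blast
  from rooted_descending[OF this] obtain t\<^sub>2 where t2: "descending t\<^sub>2" "rooted (vertices T\<^sub>2) (edges T\<^sub>2) (lead_vertex T\<^sub>2) t\<^sub>2"
    by blast
  have "(\<lambda>n. S_function \<phi>\<^sub>N\<^sub>1 \<phi>\<^sub>D\<^sub>1 (k n)) \<longlonglongrightarrow> of_real ((weight t\<^sub>1 - 1) / (weight t\<^sub>1 + 1))"
    by (rule S_function_limit[OF assms(2) t1(2) assms(8)]) (use k(2) in blast)
  moreover have "(\<lambda>n. S_function \<phi>\<^sub>N\<^sub>1 \<phi>\<^sub>D\<^sub>1 (k n)) \<longlonglongrightarrow> of_real ((weight t\<^sub>2 - 1) / (weight t\<^sub>2 + 1))"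
    using S_function_limit[OF assms(3) t2(2) assms(9)] k(2) by simp
  ultimately have "(weight t\<^sub>1 - 1) / (weight t\<^sub>1 + 1) = (weight t\<^sub>2 - 1) / (weight t\<^sub>2 + 1)"
    using LIMSEQ_unique of_real_eq_iff by blast
  \<comment> \<open>A Moebius map is injective, and the denominators are positive by nonnegativity
    of the weights.\<close>
  then have "weight t\<^sub>1 = weight t\<^sub>2"
    using weight_nonneg[of t\<^sub>1] weight_nonneg[of t\<^sub>2] by (simp add: field_simps)
  moreover have "leaves t\<^sub>1 \<le> 9" "leaves t\<^sub>2 \<le> 9"
    using assms(4,5) rooted_facts(5)[OF t1(2)] rooted_facts(5)[OF t2(2)] by simp_all
  ultimately have "t\<^sub>1 = t\<^sub>2"
    using t1(1) t2(1) by (intro weight_inj)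
  with t2(2) have "rooted (vertices T\<^sub>2) (edges T\<^sub>2) (lead_vertex T\<^sub>2) t\<^sub>1" by simp
  from rooted_isomorphic[OF t1(2) this] show ?thesis
    unfolding graph_isomorphic_def by (elim exE conjE) (intro exI conjI)
qed

end
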